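(* Let $\epsilon>0$ be any constant. For every 2D SLP $G$ of size $|G|=g$ representing a 2D string $T\in\Sigma^{r\times c}$, there exists a data structure of size $\mathcal{O}(g\cdot \log^{2+\epsilon} n)$, where $n=\max(r,c)$, that, given any $(i,j)\in[1..r]\times[1..c]$, returns $T[i,j]$ in $\mathcal{O}\!\left(\frac{\log n}{\log\log n}\right)$ time.
   Context: A 2D string over an alphabet $\Sigma$ with $r$ rows and $c$ columns is a matrix in $\Sigma^{r\times c}$; $T[i,j]$ is its entry in row $i$, column $j$. A 2D SLP is a tuple $G=(V_l,V_h,V_v,\Sigma,R,S)$ where $V_l$ (nonempty), $V_h$, $V_v$ are pairwise disjoint finite sets of literal, horizontal and vertical nonterminals, disjoint from the finite terminal alphabet $\Sigma$; $V=V_l\cup V_h\cup V_v$ and $S\in V$ is the start nonterminal. Every $N\in V$ has exactly one rule $N\to\mathrm{rhs}(N)$: if $N\in V_l$ then $\mathrm{rhs}(N)\in\Sigma$; if $N\in V_h\cup V_v$ then $\mathrm{rhs}(N)=AB$ with $A,B\in V$. There is an ordering $N_1,\dots,N_{|V|}$ of $V$ such that the right-hand side of each $N_i\in V_h\cup V_v$ uses only nonterminals $N_j$ with $j>i$. The expansion $\mathrm{exp}(N)$ is defined recursively: for $N\in V_l$ it is the $1\times 1$ matrix containing $\mathrm{rhs}(N)$; for $N\in V_h$ with $\mathrm{rhs}(N)=AB$, $\mathrm{exp}(A)$ and $\mathrm{exp}(B)$ are required to have the same number of columns and $\mathrm{exp}(N)$ is $\mathrm{exp}(A)$ placed on top of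 $\mathrm{exp}(B)$; for $N\in V_v$ with $\mathrm{rhs}(N)=AB$, $\mathrm{exp}(A)$ and $\mathrm{exp}(B)$ are required to have the same number of rows and $\mathrm{exp}(N)$ is $\mathrm{exp}(A)$ placed to the left of $\mathrm{exp}(B)$. $G$ represents $T=\mathrm{exp}(S)$. The size is $|G|=\sum_{N\in V}\max(|\mathrm{rhs}(N)|,1)$. Space is measured in machine words and time in word-RAM operations. *)

theory Defs
  imports Complex_Main "Jordan_Normal_Form.Matrix"
begin

section \<open>2D straight-line programs\<close>

text \<open>A 2D string is a matrix in the sense of \<^typ>\<open>'a mat\<close>, whose indices start at 0; the entry
  written $T[i,j]$ in 1-based notation is \<open>T $$ (i - 1, j - 1)\<close>. Terminals and nonterminals
  are symbols of one type. The rules are the function \<open>rhs\<close>, of which only the values on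
  nonterminals matter.\<close>

record 'a slp2d =
  lits :: "'a set"
  hors :: "'a set"
  vers :: "'a set"
  alphabet :: "'a set"
  rhs :: "'a \<Rightarrow> 'a list"
  start :: 'a

definition nonterminals :: "'a slp2d \<Rightarrow> 'a set" where
  "nonterminals G = lits G \<union> hors G \<union> vers G"

definition stack_mat :: "'a mat \<Rightarrow> 'a mat \<Rightarrow> 'a mat" where
  "stack_mat A B = mat (dim_row A + dim_row B) (dim_col A)
     (\<lambda>(i, j). if i < dim_row A then A $$ (i, j) else B $$ (i - dim_row A, j))"

definition beside_mat :: "'a mat \<Rightarrow> 'a mat \<Rightarrow> 'a mat" where
  "beside_mat A B = mat (dim_row A) (dim_col A + dim_col B)
     (\<lambda>(i, j). if j < dim_col A then A $$ (i, j) else B $$ (i, j - dim_col A))"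

text \<open>\<open>expands G N M\<close> says that the expansion of \<open>N\<close> is defined and equal to \<open>M\<close>; it is undefined
  if the dimensions in some rule used do not match.\<close>

inductive expands :: "'a slp2d \<Rightarrow> 'a \<Rightarrow> 'a mat \<Rightarrow> bool" for G where
  lit: "N \<in> lits G \<Longrightarrow> rhs G N = [a] \<Longrightarrow> expands G N (mat 1 1 (\<lambda>_. a))"
| hor: "N \<in> hors G \<Longrightarrow> rhs G N = [A, B] \<Longrightarrow> expands G A X \<Longrightarrow> expands G B Y \<Longrightarrow>
    dim_col X = dim_col Y \<Longrightarrow> expands G N (stack_mat X Y)"
| ver: "N \<in> vers G \<Longrightarrow> rhs G N = [A, B] \<Longrightarrow> expands G A X \<Longrightarrow> expands G B Y \<Longrightarrow>
    dim_row X = dim_row Y \<Longrightarrow> expands G N (beside_mat X Y)"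

definition wf_slp2d :: "'a slp2d \<Rightarrow> bool" where
  "wf_slp2d G \<longleftrightarrow>
     finite (lits G) \<and> finite (hors G) \<and> finite (vers G) \<and> finite (alphabet G) \<and>
     lits G \<noteq> {} \<and>
     lits G \<inter> hors G = {} \<and> lits G \<inter> vers G = {} \<and> hors G \<inter> vers G = {} \<and>
     nonterminals G \<inter> alphabet G = {} \<and>
     start G \<in> nonterminals G \<and>
     (\<forall>N \<in> lits G. \<exists>a \<in> alphabet G. rhs G N = [a]) \<and>
     (\<forall>N \<in> hors G \<union> vers G.
        \<exists>A \<in> nonterminals G. \<exists>B \<in> nonterminals G. rhs G N = [A, B]) \<and>
     (\<exists>Ns. distinct Ns \<and> set Ns = nonterminals G \<and>
        (\<forall>i < length Ns. Ns ! i \<in> hors G \<union> vers G \<longrightarrow>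
           (\<forall>X \<in> set (rhs G (Ns ! i)). \<exists>j. i < j \<and> j < length Ns \<and> X = Ns ! j))) \<and>
     (\<forall>N \<in> nonterminals G. \<exists>M. expands G N M)"

definition represents :: "'a slp2d \<Rightarrow> 'a mat \<Rightarrow> bool" where
  "represents G T \<longleftrightarrow> expands G (start G) T"

definition slp2d_size :: "'a slp2d \<Rightarrow> nat" where
  "slp2d_size G = (\<Sum>N \<in> nonterminals G. max (length (rhs G N)) 1)"

lemma expands_unique:
  assumes "wf_slp2d G" "expands G N M" "expands G N M'"
  shows "M = M'"
proof -
  have disj: "N \<in> lits G \<Longrightarrow> N \<notin> hors G" "N \<in> lits G \<Longrightarrow> N \<notin> vers G"
    "N \<in> hors G \<Longrightarrow> N \<notin> vers G" for N
    using assms(1) by (auto simp: wf_slp2d_def)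
  from assms(2,3) show ?thesis
  proof (induction arbitrary: M' rule: expands.induct)
    case (lit N a)
    from lit.prems show ?case
      by (cases rule: expands.cases) (use lit.hyps disj in simp_all)
  next
    case (hor N A B X Y)
    from hor.prems show ?case
    proof (cases rule: expands.cases)
      case hor': (hor A' B' X' Y')
      then have "expands G A X'" "expands G B Y'" using \<open>rhs G N = [A, B]\<close> by simp_all
      then show ?thesis using hor.IH hor'(1) by simp
    qed (use hor.hyps disj in simp_all)
  next
    case (ver N A B X Y)
    from ver.prems show ?case
    proof (cases rule: expands.cases)
      case ver': (ver A' B' X' Y')
      then have "expands G A X'" "expands G B Y'" using \<open>rhs G N = [A, B]\<close> by simp_all
      then show ?thesis using ver.IH ver'(1) by simp
    qed (use ver.hyps disj in simp_all)
  qed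
qed


section \<open>Word RAM\<close>

text \<open>A machine with word length \<open>w\<close> holds words, i.e. numbers below \<open>2 ^ w\<close>, in its registers and
  memory cells. Addresses are words as well, so only the cells below \<open>2 ^ w\<close> are accessible.
  All arithmetic is modulo \<open>2 ^ w\<close>. A program mentions finitely many registers. Every elementary
  instruction and every test of a branch or loop costs one time unit.\<close>

datatype binop = Add | Sub | Mul | Div | Mod | And | Or | Xor | Shl | Shr | Less | Equal

fun apply_binop :: "nat \<Rightarrow> binop \<Rightarrow> nat \<Rightarrow> nat \<Rightarrow> nat" where
  "apply_binop w Add a b = (a + b) mod 2 ^ w"
| "apply_binop w Sub a b = (a + (2 ^ w - b)) mod 2 ^ w"
| "apply_binop w Mul a b = (a * b) mod 2 ^ w"
| "apply_binop w Div a b = a div b"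
| "apply_binop w Mod a b = a mod b"
| "apply_binop w And a b = semiring_bit_operations_class.and a b"
| "apply_binop w Or a b = semiring_bit_operations_class.or a b"
| "apply_binop w Xor a b = semiring_bit_operations_class.xor a b"
| "apply_binop w Shl a b = push_bit b a mod 2 ^ w"
| "apply_binop w Shr a b = drop_bit b a"
| "apply_binop w Less a b = of_bool (a < b) mod 2 ^ w"
| "apply_binop w Equal a b = of_bool (a = b) mod 2 ^ w"

type_synonym reg = nat

datatype com =
    Skip
  | Const reg nat
  | Op reg binop reg reg
  | Load reg reg
  | Store reg reg
  | Seq com com
  | If reg com com
  | While reg com

record state =
  regs :: "reg \<Rightarrow> nat"
  mem :: "nat \<Rightarrow> nat"

definition wf_state :: "nat \<Rightarrow> state \<Rightarrow> bool" where
  "wf_state w s \<longleftrightarrow> (\<forall>x. regs s x < 2 ^ w) \<and> (\<forall>a. mem s a < 2 ^ w)"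

text \<open>\<open>exec w c s t s'\<close>: started in \<open>s\<close>, program \<open>c\<close> halts after \<open>t\<close> time units in \<open>s'\<close>.\<close>

inductive exec :: "nat \<Rightarrow> com \<Rightarrow> state \<Rightarrow> nat \<Rightarrow> state \<Rightarrow> bool" for w where
  Skip: "exec w Skip s 1 s"
| Const: "exec w (Const x k) s 1 (s\<lparr>regs := (regs s)(x := k mod 2 ^ w)\<rparr>)"
| Op: "exec w (Op x f y z) s 1
    (s\<lparr>regs := (regs s)(x := apply_binop w f (regs s y) (regs s z))\<rparr>)"
| Load: "exec w (Load x y) s 1 (s\<lparr>regs := (regs s)(x := mem s (regs s y))\<rparr>)"
| Store: "exec w (Store x y) s 1 (s\<lparr>mem := (mem s)(regs s x := regs s y)\<rparr>)"
| Seq: "exec w c s t s' \<Longrightarrow> exec w d s' u s'' \<Longrightarrow> exec w (Seq c d) s (t + u) s''"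
| If_true: "regs s x \<noteq> 0 \<Longrightarrow> exec w c s t s' \<Longrightarrow> exec w (If x c d) s (1 + t) s'"
| If_false: "regs s x = 0 \<Longrightarrow> exec w d s t s' \<Longrightarrow> exec w (If x c d) s (1 + t) s'"
| While_false: "regs s x = 0 \<Longrightarrow> exec w (While x c) s 1 s"
| While_true: "regs s x \<noteq> 0 \<Longrightarrow> exec w c s t s' \<Longrightarrow> exec w (While x c) s' u s'' \<Longrightarrow>
    exec w (While x c) s (1 + t + u) s''"

inductive_cases exec_elims:
  "exec w Skip s t s'"
  "exec w (Const x k) s t s'"
  "exec w (Op x f y z) s t s'"
  "exec w (Load x y) s t s'"
  "exec w (Store x y) s t s'"
  "exec w (Seq c d) s t s'"
  "exec w (If x c d) s t s'"
  "exec w (While x c) s t s'"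

lemma exec_deterministic:
  "exec w c s t s' \<Longrightarrow> exec w c s t' s'' \<Longrightarrow> t' = t \<and> s'' = s'"
proof (induction arbitrary: t' s'' rule: exec.induct)
  case (Seq c s t s' d u s2)
  from Seq.prems show ?case by (rule exec_elims) (use Seq.IH in blast)
next
  case (If_true s x c t s' d)
  from If_true.prems show ?case
    by (rule exec_elims) (use If_true.hyps(1) If_true.IH in \<open>simp_all, blast?\<close>)
next
  case (If_false s x d t s' c)
  from If_false.prems show ?case
    by (rule exec_elims) (use If_false.hyps(1) If_false.IH in \<open>simp_all, blast?\<close>)
next
  case (While_false s x c)
  from While_false.prems show ?case by (rule exec_elims) (use While_false.hyps in simp_all)
next
  case (While_true s x c t s' u s2)
  from While_true.prems show ?case
    by (rule exec_elims) (use While_true.hyps(1) While_true.IH in \<open>simp_all, blast?\<close>)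
qed (erule exec_elims, simp)+


section \<open>Random-access data structures\<close>

text \<open>The data structure is an array of words stored from address 0 on; its size is its length.\<close>

definition stored :: "nat list \<Rightarrow> state \<Rightarrow> bool" where
  "stored D s \<longleftrightarrow> (\<forall>a < length D. mem s a = D ! a)"

text \<open>A query expects \<open>i\<close> and \<open>j\<close> in registers 0 and 1 and leaves the word coding the symbol
  $T[i,j]$ in register 0. The other registers and the cells outside the data structure are
  arbitrary initially and may be used as work space. The data structure must be intact
  at the end, so that any sequence of queries is answered correctly.\<close>

definition answers_access ::
  "nat \<Rightarrow> com \<Rightarrow> nat list \<Rightarrow> ('a \<Rightarrow> nat) \<Rightarrow> 'a mat \<Rightarrow> real \<Rightarrow> bool" where
  "answers_access w P D code T time \<longleftrightarrow>
     (\<forall>i \<in> {1..dim_row T}. \<forall>j \<in> {1..dim_col T}. \<forall>s.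
        wf_state w s \<and> stored D s \<and> regs s 0 = i \<and> regs s 1 = j \<longrightarrow>
        (\<exists>t s'. exec w P s t s' \<and> real t \<le> time \<and>
           regs s' 0 = code (T $$ (i - 1, j - 1)) \<and> stored D s'))"

text \<open>The usual convention for logarithms in asymptotic bounds: it keeps \<open>log n\<close> and
  \<open>log log n\<close> from vanishing or being undefined for \<open>n \<le> 3\<close>, and for larger \<open>n\<close> changes nothing.\<close>

definition lg :: "real \<Rightarrow> real" where
  "lg x = max 1 (log 2 x)"

end

theory Submission
  imports Defs
begin

text \<open>Fix \<open>k\<close> of order \<open>\<epsilon> log log n\<close>. During a query the point is known to lie in a corner region of
  some expansion \<open>exp(N)\<close>, with at most \<open>2\<^sup>k\<^sup>p\<close> rows and \<open>2\<^sup>k\<^sup>q\<close> columns. Divide the region into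
  \<open>2\<^sup>k \<times> 2\<^sup>k\<close> blocks and let \<open>N'\<close> be the smallest descendant of \<open>N\<close> whose expansion contains the
  block \<open>B\<close> of the point. It depends on \<open>B\<close> only, so it can be tabulated. The line at which
  \<open>exp(N')\<close> is split meets \<open>B\<close>; so in the child of \<open>N'\<close> that contains it, the point is within one
  block length of that side. In the other direction the region still touches the same side of the
  child, because a region that touches a side of \<open>exp(N)\<close> meets every descendant in a region
  touching the corresponding side. Hence \<open>p\<close> or \<open>q\<close> drops by one in constant time, and after
  \<open>O(log n / k)\<close> steps a terminal is reached. There are \<open>O(g (log n)\<^sup>2)\<close> corner regions with \<open>4\<^sup>k\<close>
  blocks each.\<close>

section \<open>Geometry of expansions\<close>

definition placed :: "'a mat \<Rightarrow> 'a mat \<Rightarrow> nat \<Rightarrow> nat \<Rightarrow> bool" where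
  "placed X M dr dc \<longleftrightarrow> dr + dim_row X \<le> dim_row M \<and> dc + dim_col X \<le> dim_col M \<and>
     (\<forall>i < dim_row X. \<forall>j < dim_col X. M $$ (dr + i, dc + j) = X $$ (i, j))"

lemma placed_trans:
  assumes "placed X Y dr dc" "placed Y M er ec"
  shows "placed X M (er + dr) (ec + dc)"
  using assms by (auto simp: placed_def add.assoc)

lemma placed_index:
  assumes "placed X M dr dc" "dr \<le> i" "i < dr + dim_row X" "dc \<le> j" "j < dc + dim_col X"
  shows "M $$ (i, j) = X $$ (i - dr, j - dc)"
proof -
  have "\<forall>i < dim_row X. \<forall>j < dim_col X. M $$ (dr + i, dc + j) = X $$ (i, j)"
    using assms(1) by (simp add: placed_def)
  moreover have "i - dr < dim_row X" "j - dc < dim_col X" using assms by auto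
  ultimately have "M $$ (dr + (i - dr), dc + (j - dc)) = X $$ (i - dr, j - dc)" by blast
  then show ?thesis using assms by simp
qed

lemma placed_stack:
  assumes "dim_col X = dim_col Y"
  shows "placed X (stack_mat X Y) 0 0" "placed Y (stack_mat X Y) (dim_row X) 0"
  using assms by (auto simp: placed_def stack_mat_def)

lemma placed_beside:
  assumes "dim_row X = dim_row Y"
  shows "placed X (beside_mat X Y) 0 0" "placed Y (beside_mat X Y) 0 (dim_col X)"
  using assms by (auto simp: placed_def beside_mat_def)

lemma expands_nonterminal: "expands G N M \<Longrightarrow> N \<in> nonterminals G"
  by (cases rule: expands.cases) (auto simp: nonterminals_def)

lemma expands_entry_alphabet:
  assumes "expands G N M" "wf_slp2d G" "i < dim_row M" "j < dim_col M"
  shows "M $$ (i, j) \<in> alphabet G"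
  using assms
proof (induction arbitrary: i j rule: expands.induct)
  case (lit N a)
  then show ?case by (fastforce simp: wf_slp2d_def)
qed (auto simp: stack_mat_def beside_mat_def)

section \<open>Blocks that are crossed by a split line, and constant blocks\<close>

definition cut_rows :: "'a slp2d \<Rightarrow> 'a mat \<Rightarrow> nat \<Rightarrow> nat \<Rightarrow> nat \<Rightarrow> nat \<Rightarrow> bool" where
  "cut_rows G M r0 r1 c0 c1 \<longleftrightarrow> (\<exists>A B X Y dr dc. expands G A X \<and> expands G B Y \<and>
     placed X M dr dc \<and> placed Y M (dr + dim_row X) dc \<and> dim_col X = dim_col Y \<and>
     dr \<le> r0 \<and> r0 < dr + dim_row X \<and> dr + dim_row X < r1 \<and> r1 \<le> dr + dim_row X + dim_row Y \<and>
     dc \<le> c0 \<and> c1 \<le> dc + dim_col X)"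

definition cut_cols :: "'a slp2d \<Rightarrow> 'a mat \<Rightarrow> nat \<Rightarrow> nat \<Rightarrow> nat \<Rightarrow> nat \<Rightarrow> bool" where
  "cut_cols G M r0 r1 c0 c1 \<longleftrightarrow> (\<exists>A B X Y dr dc. expands G A X \<and> expands G B Y \<and>
     placed X M dr dc \<and> placed Y M dr (dc + dim_col X) \<and> dim_row X = dim_row Y \<and>
     dc \<le> c0 \<and> c0 < dc + dim_col X \<and> dc + dim_col X < c1 \<and> c1 \<le> dc + dim_col X + dim_col Y \<and>
     dr \<le> r0 \<and> r1 \<le> dr + dim_row X)"

text \<open>Describes a block that lies inside the expansion of a literal: a single word then
  answers for the whole block.\<close>

definition constant_on :: "'a mat \<Rightarrow> nat \<Rightarrow> nat \<Rightarrow> nat \<Rightarrow> nat \<Rightarrow> bool" where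
  "constant_on M r0 r1 c0 c1 \<longleftrightarrow>
     (\<exists>a. \<forall>i j. r0 \<le> i \<and> i < r1 \<and> c0 \<le> j \<and> j < c1 \<longrightarrow> M $$ (i, j) = a)"

lemma cut_rows_placed:
  assumes "cut_rows G X r0 r1 c0 c1" "placed X M dr dc"
  shows "cut_rows G M (dr + r0) (dr + r1) (dc + c0) (dc + c1)"
proof -
  obtain A B Y Z er ec where *: "expands G A Y" "expands G B Z"
     "placed Y X er ec" "placed Z X (er + dim_row Y) ec" "dim_col Y = dim_col Z"
     "er \<le> r0" "r0 < er + dim_row Y" "er + dim_row Y < r1" "r1 \<le> er + dim_row Y + dim_row Z"
     "ec \<le> c0" "c1 \<le> ec + dim_col Y"
    using assms(1) unfolding cut_rows_def by blast
  have "placed Y M (dr + er) (dc + ec)" "placed Z M (dr + er + dim_row Y) (dc + ec)"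
    using placed_trans[OF *(3) assms(2)] placed_trans[OF *(4) assms(2)] by (simp_all add: add.assoc)
  then show ?thesis unfolding cut_rows_def
    by (intro exI[of _ A] exI[of _ B] exI[of _ Y] exI[of _ Z] exI[of _ "dr + er"] exI[of _ "dc + ec"])
      (use * in auto)
qed

lemma cut_cols_placed:
  assumes "cut_cols G X r0 r1 c0 c1" "placed X M dr dc"
  shows "cut_cols G M (dr + r0) (dr + r1) (dc + c0) (dc + c1)"
proof -
  obtain A B Y Z er ec where *: "expands G A Y" "expands G B Z"
     "placed Y X er ec" "placed Z X er (ec + dim_col Y)" "dim_row Y = dim_row Z"
     "ec \<le> c0" "c0 < ec + dim_col Y" "ec + dim_col Y < c1" "c1 \<le> ec + dim_col Y + dim_col Z"
     "er \<le> r0" "r1 \<le> er + dim_row Y"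
    using assms(1) unfolding cut_cols_def by blast
  have "placed Y M (dr + er) (dc + ec)" "placed Z M (dr + er) (dc + ec + dim_col Y)"
    using placed_trans[OF *(3) assms(2)] placed_trans[OF *(4) assms(2)] by (simp_all add: add.assoc)
  then show ?thesis unfolding cut_cols_def
    by (intro exI[of _ A] exI[of _ B] exI[of _ Y] exI[of _ Z] exI[of _ "dr + er"] exI[of _ "dc + ec"])
      (use * in auto)
qed

lemma constant_on_placed:
  assumes "constant_on X r0 r1 c0 c1" "placed X M dr dc" "r1 \<le> dim_row X" "c1 \<le> dim_col X"
  shows "constant_on M (dr + r0) (dr + r1) (dc + c0) (dc + c1)"
proof -
  obtain a where a: "\<And>i j. r0 \<le> i \<Longrightarrow> i < r1 \<Longrightarrow> c0 \<le> j \<Longrightarrow> j < c1 \<Longrightarrow> X $$ (i, j) = a"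
    using assms(1) unfolding constant_on_def by blast
  have "M $$ (i, j) = a" if "dr + r0 \<le> i" "i < dr + r1" "dc + c0 \<le> j" "j < dc + c1" for i j
  proof -
    have "M $$ (i, j) = X $$ (i - dr, j - dc)"
      by (rule placed_index[OF assms(2)]) (use that assms(3,4) in auto)
    also have "\<dots> = a" by (rule a) (use that in auto)
    finally show ?thesis .
  qed
  then show ?thesis unfolding constant_on_def by blast
qed

lemma cut_or_constant_placed:
  assumes "cut_rows G X r0 r1 c0 c1 \<or> cut_cols G X r0 r1 c0 c1 \<or> constant_on X r0 r1 c0 c1"
    and "placed X M dr dc" "r1 \<le> dim_row X" "c1 \<le> dim_col X"
  shows "cut_rows G M (dr + r0) (dr + r1) (dc + c0) (dc + c1) \<or>
    cut_cols G M (dr + r0) (dr + r1) (dc + c0) (dc + c1) \<or>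
    constant_on M (dr + r0) (dr + r1) (dc + c0) (dc + c1)"
  using assms cut_rows_placed cut_cols_placed constant_on_placed by metis

text \<open>The induction descends to the child that contains the whole block, until the split line
  leaves part of the block on either side or a literal is reached. The placement lemmas carry the
  result back up to \<open>M\<close>.\<close>

lemma expands_cut_or_constant:
  assumes "expands G N M" "r0 < r1" "r1 \<le> dim_row M" "c0 < c1" "c1 \<le> dim_col M"
  shows "cut_rows G M r0 r1 c0 c1 \<or> cut_cols G M r0 r1 c0 c1 \<or> constant_on M r0 r1 c0 c1"
  using assms
proof (induction arbitrary: r0 r1 c0 c1 rule: expands.induct)
  case (lit N a)
  then show ?case by (auto simp: constant_on_def)
next
  case (hor N A B X Y)
  note pl = placed_stack[OF hor.hyps(5)]
  have dims: "dim_row (stack_mat X Y) = dim_row X + dim_row Y" "dim_col (stack_mat X Y) = dim_col X"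
    by (simp_all add: stack_mat_def)
  consider "r1 \<le> dim_row X" | "dim_row X \<le> r0" | "r0 < dim_row X" "dim_row X < r1" by linarith
  then show ?case
  proof cases
    case 1
    then have "cut_rows G X r0 r1 c0 c1 \<or> cut_cols G X r0 r1 c0 c1 \<or> constant_on X r0 r1 c0 c1"
      using hor.IH(1) hor.prems dims by simp
    from cut_or_constant_placed[OF this pl(1)] show ?thesis using 1 hor.prems dims by simp
  next
    case 2
    define s0 s1 where "s0 = r0 - dim_row X" and "s1 = r1 - dim_row X"
    have s: "s0 < s1" "s1 \<le> dim_row Y" "r0 = dim_row X + s0" "r1 = dim_row X + s1"
      using 2 hor.prems dims by (auto simp: s0_def s1_def)
    then have "cut_rows G Y s0 s1 c0 c1 \<or> cut_cols G Y s0 s1 c0 c1 \<or> constant_on Y s0 s1 c0 c1"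
      using hor.IH(2) hor.prems dims hor.hyps by simp
    from cut_or_constant_placed[OF this pl(2)] show ?thesis using s hor.prems hor.hyps dims by simp
  next
    case 3
    have "cut_rows G (stack_mat X Y) r0 r1 c0 c1" unfolding cut_rows_def
      by (intro exI[of _ A] exI[of _ B] exI[of _ X] exI[of _ Y] exI[of _ 0])
        (use 3 pl hor dims in auto)
    then show ?thesis by blast
  qed
next
  case (ver N A B X Y)
  note pl = placed_beside[OF ver.hyps(5)]
  have dims: "dim_col (beside_mat X Y) = dim_col X + dim_col Y" "dim_row (beside_mat X Y) = dim_row X"
    by (simp_all add: beside_mat_def)
  consider "c1 \<le> dim_col X" | "dim_col X \<le> c0" | "c0 < dim_col X" "dim_col X < c1" by linarith
  then show ?case
  proof cases
    case 1
    then have "cut_rows G X r0 r1 c0 c1 \<or> cut_cols G X r0 r1 c0 c1 \<or> constant_on X r0 r1 c0 c1"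
      using ver.IH(1) ver.prems dims by simp
    from cut_or_constant_placed[OF this pl(1)] show ?thesis using 1 ver.prems dims by simp
  next
    case 2
    define s0 s1 where "s0 = c0 - dim_col X" and "s1 = c1 - dim_col X"
    have s: "s0 < s1" "s1 \<le> dim_col Y" "c0 = dim_col X + s0" "c1 = dim_col X + s1"
      using 2 ver.prems dims by (auto simp: s0_def s1_def)
    then have "cut_rows G Y r0 r1 s0 s1 \<or> cut_cols G Y r0 r1 s0 s1 \<or> constant_on Y r0 r1 s0 s1"
      using ver.IH(2) ver.prems dims ver.hyps by simp
    from cut_or_constant_placed[OF this pl(2)] show ?thesis using s ver.prems ver.hyps dims by simp
  next
    case 3
    have "cut_cols G (beside_mat X Y) r0 r1 c0 c1" unfolding cut_cols_def
      by (intro exI[of _ A] exI[of _ B] exI[of _ X] exI[of _ Y] exI[of _ 0])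
        (use 3 pl ver dims in auto)
    then show ?thesis by blast
  qed
qed


section \<open>Query programs\<close>

text \<open>On a loop \<open>run\<close> is junk; it is only used for loop-free programs.\<close>

fun run :: "nat \<Rightarrow> com \<Rightarrow> state \<Rightarrow> state" where
  "run w Skip s = s"
| "run w (Const x c) s = s\<lparr>regs := (regs s)(x := c mod 2 ^ w)\<rparr>"
| "run w (Op x f y z) s = s\<lparr>regs := (regs s)(x := apply_binop w f (regs s y) (regs s z))\<rparr>"
| "run w (Load x y) s = s\<lparr>regs := (regs s)(x := mem s (regs s y))\<rparr>"
| "run w (Store x y) s = s\<lparr>mem := (mem s)(regs s x := regs s y)\<rparr>"
| "run w (Seq c d) s = run w d (run w c s)"
| "run w (If x c d) s = (if regs s x \<noteq> 0 then run w c s else run w d s)"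
| "run w (While x c) s = s"

fun loop_free :: "com \<Rightarrow> bool" where
  "loop_free (Seq c d) \<longleftrightarrow> loop_free c \<and> loop_free d"
| "loop_free (If x c d) \<longleftrightarrow> loop_free c \<and> loop_free d"
| "loop_free (While x c) \<longleftrightarrow> False"
| "loop_free _ \<longleftrightarrow> True"

fun cost :: "com \<Rightarrow> nat" where
  "cost (Seq c d) = cost c + cost d"
| "cost (If x c d) = 1 + max (cost c) (cost d)"
| "cost _ = 1"

text \<open>Reduces reasoning about the machine to evaluating \<open>run\<close> by simplification;
  \<open>cost\<close> charges the more expensive branch of every conditional.\<close>

lemma exec_run:
  assumes "loop_free c"
  shows "\<exists>t \<le> cost c. exec w c s t (run w c s)"
  using assms
proof (induction c arbitrary: s)
  case (Seq c d)
  then obtain t u where "t \<le> cost c" "exec w c s t (run w c s)"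
    "u \<le> cost d" "exec w d (run w c s) u (run w d (run w c s))" by fastforce
  then show ?case by (auto intro!: exI[of _ "t + u"] exec.Seq)
next
  case (If x c d)
  show ?case
  proof (cases "regs s x = 0")
    case True
    obtain t where "t \<le> cost d" "exec w d s t (run w d s)" using If by fastforce
    then show ?thesis using True by (auto intro!: exI[of _ "1 + t"] exec.If_false)
  next
    case False
    obtain t where "t \<le> cost c" "exec w c s t (run w c s)" using If by fastforce
    then have "exec w (If x c d) s (1 + t) (run w (If x c d) s)" "1 + t \<le> cost (If x c d)"
      using False by (simp_all only: exec.If_true run.simps if_True not_False_eq_True cost.simps)
    then show ?thesis by blast
  qed
qed (auto intro: exec.intros[unfolded One_nat_def])

section \<open>The query program\<close>

primrec seqs :: "com list \<Rightarrow> com" where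
  "seqs [] = Skip"
| "seqs (c # cs) = Seq c (seqs cs)"

text \<open>Registers 0 and 1 hold the coordinates of the point, register 2 an address,
  register 3 is nonzero as long as the search goes on.\<close>

definition find_entry :: com where
  "find_entry = seqs
     [Const 7 1,
      Load 5 2, Op 6 Shr 0 5, Op 2 Add 2 7,
      Load 5 2, Op 8 Shr 1 5, Op 2 Add 2 7,
      Load 5 2, Op 6 Shl 6 5, Op 6 Add 6 8, Op 2 Add 2 7,
      Const 5 9, Op 6 Mul 5 6, Op 2 Add 2 6,
      Load 3 2, Op 2 Add 2 7]"

text \<open>Each of the two targets occupies three words: two offsets and an address. If the test
  fails, the first triple is skipped. Register 7 still holds the 1 from
  \<open>find_entry\<close>.\<close>

definition follow_branch :: com where
  "follow_branch = seqs
     [Load 5 2, Op 5 Less 0 5, Op 2 Add 2 7,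
      Load 6 2, Op 6 Less 1 6, Op 2 Add 2 7,
      Op 5 And 5 6,
      If 5 Skip (Seq (Const 6 3) (Op 2 Add 2 6)),
      Load 5 2, Op 0 Add 0 5, Op 2 Add 2 7,
      Load 5 2, Op 1 Add 1 5, Op 2 Add 2 7,
      Load 2 2]"

text \<open>The tag in register 3 is also the loop condition: a leaf has tag 0, so reading its code
  ends the search.\<close>

definition search_step :: com where
  "search_step = Seq find_entry (If 3 follow_branch (Load 0 2))"

lemma loop_free_search_step: "loop_free search_step"
  by (simp add: search_step_def find_entry_def follow_branch_def)

text \<open>Coordinates become 0-based. The search starts with the region whose table begins at
  address 0.\<close>

definition search :: com where
  "search = Seq (seqs [Const 4 1, Op 0 Sub 0 4, Op 1 Sub 1 4, Const 2 0, Const 3 1])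
     (While 3 search_step)"

text \<open>A table has a header of 3 words and then 9 words per block, so \<open>small\<close> says
  that the last word of entry \<open>b\<close> is addressable. This bounds all intermediate results
  and removes every reduction modulo \<open>2 ^ w\<close>.\<close>

lemma run_find_entry:
  assumes "regs s 0 = u" "regs s (Suc 0) = v" "regs s 2 = a"
    and "mem s a = su" "mem s (Suc a) = sv" "mem s (Suc (Suc a)) = k"
    and b: "u div 2 ^ su * 2 ^ k + v div 2 ^ sv = b" and small: "a + 3 + 9 * b + 8 < 2 ^ w"
  shows "regs (run w find_entry s) 0 = u" "regs (run w find_entry s) (Suc 0) = v"
    "regs (run w find_entry s) 2 = a + 3 + 9 * b + 1"
    "regs (run w find_entry s) 3 = mem s (a + 3 + 9 * b)"
    "regs (run w find_entry s) 7 = 1" "mem (run w find_entry s) = mem s"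
proof -
  have lt: "Suc a < 2 ^ w" "Suc (Suc a) < 2 ^ w" "Suc (Suc (Suc a)) < 2 ^ w"
    "Suc 0 < 2 ^ w" "9 < (2::nat) ^ w" "u div 2 ^ su * 2 ^ k < 2 ^ w" "b < 2 ^ w" "9 * b < 2 ^ w"
    "Suc (Suc (Suc (a + 9 * b))) < 2 ^ w" "4 + (a + 9 * b) < 2 ^ w"
    "Suc (Suc (Suc (Suc (a + 9 * b)))) < 2 ^ w" "0 < w"
    using small b by (cases w; simp)+
  have a3: "a + 3 + 9 * b = Suc (Suc (Suc (a + 9 * b)))" by simp
  show "regs (run w find_entry s) 0 = u" "regs (run w find_entry s) (Suc 0) = v"
    "regs (run w find_entry s) 2 = a + 3 + 9 * b + 1"
    "regs (run w find_entry s) 3 = mem s (a + 3 + 9 * b)"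
    "regs (run w find_entry s) 7 = 1" "mem (run w find_entry s) = mem s"
    unfolding a3 by (simp_all add: find_entry_def assms(1-7) drop_bit_eq_div push_bit_eq_mult lt)
qed

lemma run_follow_branch:
  assumes "regs s 0 = u" "regs s (Suc 0) = v" "regs s 2 = Suc e" "regs s 7 = 1" "e + 8 < 2 ^ w"
    and "mem s (Suc e) = tu" "mem s (Suc (Suc e)) = tv"
    and "f = (if u < tu \<and> v < tv then e + 3 else e + 6)"
  shows "regs (run w follow_branch s) 0 = (u + mem s f) mod 2 ^ w"
    "regs (run w follow_branch s) (Suc 0) = (v + mem s (Suc f)) mod 2 ^ w"
    "regs (run w follow_branch s) 2 = mem s (Suc (Suc f))"
    "regs (run w follow_branch s) 3 = regs s 3" "mem (run w follow_branch s) = mem s"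
proof -
  have lt: "Suc (Suc e) < 2 ^ w" "Suc (Suc (Suc e)) < 2 ^ w" "Suc (Suc (Suc (Suc e))) < 2 ^ w"
    "Suc (Suc (Suc (Suc (Suc e)))) < 2 ^ w" "Suc (Suc (Suc (Suc (Suc (Suc e))))) < 2 ^ w"
    "Suc (Suc (Suc (Suc (Suc (Suc (Suc e)))))) < 2 ^ w"
    "Suc (Suc (Suc (Suc (Suc (Suc (Suc (Suc e))))))) < 2 ^ w" "Suc 0 < 2 ^ w" "3 < (2::nat) ^ w" "0 < w"
    using assms(5) by (cases w; simp)+
  have add: "x + 3 = Suc (Suc (Suc x))" "x + 6 = Suc (Suc (Suc (Suc (Suc (Suc x)))))"
    for x :: nat by simp_all
  show "regs (run w follow_branch s) 0 = (u + mem s f) mod 2 ^ w"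
    "regs (run w follow_branch s) (Suc 0) = (v + mem s (Suc f)) mod 2 ^ w"
    "regs (run w follow_branch s) 2 = mem s (Suc (Suc f))"
    "regs (run w follow_branch s) 3 = regs s 3" "mem (run w follow_branch s) = mem s"
    by (cases "u < tu"; cases "v < tv"; simp add: follow_branch_def assms(1-4,6-8) lt add)+
qed

text \<open>\<open>Branch tu tv du1 dv1 r1 du2 dv2 r2\<close> sends a point \<open>(u, v)\<close> with \<open>u < tu\<close> and \<open>v < tv\<close>, shifted by
  \<open>(du1, dv1)\<close>, to region \<open>r1\<close>, and any other point, shifted by \<open>(du2, dv2)\<close>, to region \<open>r2\<close>.\<close>

datatype entry = Leaf nat | Branch nat nat int int nat int int nat

text \<open>Word 0 is the tag. A leaf fills the other eight words with its code, so that all entries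
  have equal length. Offsets may be negative and are stored modulo \<open>2 ^ w\<close>; a target is
  stored as an address, \<open>z\<close> being the length of one region's table.\<close>

fun entry_word :: "nat \<Rightarrow> nat \<Rightarrow> entry \<Rightarrow> nat \<Rightarrow> nat" where
  "entry_word w z (Leaf a) i = (if i = 0 then 0 else a)"
| "entry_word w z (Branch tu tv du1 dv1 r1 du2 dv2 r2) i =
     [1, tu, tv, nat (du1 mod 2 ^ w), nat (dv1 mod 2 ^ w), r1 * z,
      nat (du2 mod 2 ^ w), nat (dv2 mod 2 ^ w), r2 * z] ! i"

section \<open>Tables in memory and correctness of the search\<close>

lemma word_add_offset:
  assumes "0 \<le> int u + d" "int u + d < 2 ^ w"
  shows "(u + nat (d mod 2 ^ w)) mod 2 ^ w = nat (int u + d)"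
proof -
  have "int ((u + nat (d mod 2 ^ w)) mod 2 ^ w) = (int u + d mod 2 ^ w) mod 2 ^ w"
    by (simp add: zmod_int)
  also have "\<dots> = int u + d" using assms by (simp add: mod_add_right_eq)
  finally show ?thesis by simp
qed

text \<open>There are \<open>R\<close> regions, each with a table of 3 header words and
  \<open>4 ^ k\<close> entries of 9 words. \<open>fits\<close> makes every address a word, and
  \<open>shifts\<close> does so for the first two header words.\<close>

locale block_tables =
  fixes w k R :: nat and su sv :: "nat \<Rightarrow> nat" and ent :: "nat \<Rightarrow> nat \<Rightarrow> nat \<Rightarrow> entry"
  assumes fits: "R * (3 + 9 * 4 ^ k) \<le> 2 ^ w"
    and shifts: "\<And>r. r < R \<Longrightarrow> su r < 2 ^ w" "\<And>r. r < R \<Longrightarrow> sv r < 2 ^ w"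
begin

definition stride :: nat where "stride = 3 + 9 * 4 ^ k"

definition cell :: "nat \<Rightarrow> nat \<Rightarrow> nat" where
  "cell r i = (if i = 0 then su r else if i = 1 then sv r else if i = 2 then k
     else entry_word w stride (ent r ((i - 3) div 9 div 2 ^ k) ((i - 3) div 9 mod 2 ^ k)) ((i - 3) mod 9))"

text \<open>The reduction makes every cell a word whatever \<open>ent\<close> contains; it leaves
  alone the words that a search described by \<open>finds\<close> reads.\<close>

definition table :: "nat list" where
  "table = map (\<lambda>a. cell (a div stride) (a mod stride) mod 2 ^ w) [0..<R * stride]"

lemma length_table: "length table = R * stride"
  by (simp add: table_def)

lemma table_bound: "x \<in> set table \<Longrightarrow> x < 2 ^ w"
  by (auto simp: table_def)

lemma address_bound:
  assumes "r < R" "i < stride"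
  shows "r * stride + i < R * stride"
proof -
  have "r * stride + i < Suc r * stride" using assms by simp
  also have "\<dots> \<le> R * stride" using assms by (intro mult_right_mono) auto
  finally show ?thesis .
qed

lemma address_word: "r < R \<Longrightarrow> i < stride \<Longrightarrow> r * stride + i < 2 ^ w"
  using address_bound[of r i] fits by (simp add: stride_def)

lemma stored_table:
  assumes "stored table s" "r < R" "i < stride"
  shows "mem s (r * stride + i) = cell r i mod 2 ^ w"
  using assms address_bound[of r i] by (simp add: stored_def length_table table_def)

text \<open>The side conditions are exactly what keeps all machine arithmetic free of overflow.\<close>

inductive finds :: "nat \<Rightarrow> nat \<Rightarrow> nat \<Rightarrow> nat \<Rightarrow> nat \<Rightarrow> bool" where
  leaf: "r < R \<Longrightarrow> u div 2 ^ su r < 2 ^ k \<Longrightarrow> v div 2 ^ sv r < 2 ^ k \<Longrightarrow>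
    ent r (u div 2 ^ su r) (v div 2 ^ sv r) = Leaf a \<Longrightarrow> a < 2 ^ w \<Longrightarrow> finds r u v a 0"
| branch: "r < R \<Longrightarrow> u div 2 ^ su r < 2 ^ k \<Longrightarrow> v div 2 ^ sv r < 2 ^ k \<Longrightarrow>
    ent r (u div 2 ^ su r) (v div 2 ^ sv r) = Branch tu tv du1 dv1 r1 du2 dv2 r2 \<Longrightarrow>
    tu < 2 ^ w \<Longrightarrow> tv < 2 ^ w \<Longrightarrow>
    (r', du, dv) = (if u < tu \<and> v < tv then (r1, du1, dv1) else (r2, du2, dv2)) \<Longrightarrow>
    0 \<le> int u + du \<Longrightarrow> int u + du < 2 ^ w \<Longrightarrow> 0 \<le> int v + dv \<Longrightarrow> int v + dv < 2 ^ w \<Longrightarrow>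
    finds r' (nat (int u + du)) (nat (int v + dv)) a m \<Longrightarrow> finds r u v a (Suc m)"

lemma finds_region: "finds r u v a m \<Longrightarrow> r < R"
  by (cases rule: finds.cases) auto

lemma entry_cell:
  assumes "bu < 2 ^ k" "bv < 2 ^ k" "i < 9"
  shows "3 + 9 * (bu * 2 ^ k + bv) + i < stride"
    and "cell r (3 + 9 * (bu * 2 ^ k + bv) + i) = entry_word w stride (ent r bu bv) i"
proof -
  have "bu * 2 ^ k + bv < Suc bu * 2 ^ k" using assms by simp
  also have "\<dots> \<le> 2 ^ k * 2 ^ k" using assms by (intro mult_right_mono) auto
  also have "\<dots> = (4::nat) ^ k" by (simp flip: power_mult_distrib)
  finally show "3 + 9 * (bu * 2 ^ k + bv) + i < stride" using assms(3) by (simp add: stride_def)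
  have "(9 * b + i) div 9 = b" "(9 * b + i) mod 9 = i" for b using assms(3) by simp_all
  then show "cell r (3 + 9 * (bu * 2 ^ k + bv) + i) = entry_word w stride (ent r bu bv) i"
    using assms(2) by (simp add: cell_def add.assoc del: distrib_left_numeral)
qed

lemma
  assumes "stored table s" "r < R" "u div 2 ^ su r < 2 ^ k" "v div 2 ^ sv r < 2 ^ k"
    and "regs s 0 = u" "regs s 1 = v" "regs s 2 = r * stride"
  defines "e \<equiv> r * stride + 3 + 9 * (u div 2 ^ su r * 2 ^ k + v div 2 ^ sv r)"
    and "en \<equiv> ent r (u div 2 ^ su r) (v div 2 ^ sv r)"
  shows entry_mem: "\<And>i. i < 9 \<Longrightarrow> mem s (e + i) = entry_word w stride en i mod 2 ^ w"
    and entry_address: "e + 8 < 2 ^ w"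
    and entry_found: "regs (run w find_entry s) 0 = u" "regs (run w find_entry s) (Suc 0) = v"
      "regs (run w find_entry s) 2 = Suc e"
      "regs (run w find_entry s) 3 = entry_word w stride en 0 mod 2 ^ w"
      "regs (run w find_entry s) 7 = 1" "mem (run w find_entry s) = mem s"
proof -
  let ?b = "u div 2 ^ su r * 2 ^ k + v div 2 ^ sv r"
  note ec = entry_cell[OF assms(3,4)]
  show mem: "mem s (e + i) = entry_word w stride en i mod 2 ^ w" if "i < 9" for i
    using stored_table[OF assms(1,2) ec(1)[OF that]] ec(2)[OF that, of r]
    by (simp only: e_def en_def add.assoc)
  show e8: "e + 8 < 2 ^ w"
    using address_word[OF assms(2) ec(1)[of 8]] by (simp only: e_def add.assoc)
  \<comment> \<open>The third header word is \<open>k\<close> itself and has to survive the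
    reduction modulo \<open>2 ^ w\<close>. It does, being smaller than the length of a
    table.\<close>
  have "k < 2 ^ k" by simp
  also have "(2::nat) ^ k \<le> 4 ^ k" by (simp add: power_mono)
  finally have "k < stride" by (simp add: stride_def)
  then have kw: "k < 2 ^ w" using address_word[OF assms(2), of k] by simp
  have m: "mem s (r * stride) = su r" "mem s (Suc (r * stride)) = sv r"
    "mem s (Suc (Suc (r * stride))) = k"
    using stored_table[OF assms(1,2), of 0] stored_table[OF assms(1,2), of 1]
      stored_table[OF assms(1,2), of 2] shifts assms(2) kw
    by (simp_all add: cell_def stride_def)
  have v: "regs s (Suc 0) = v" using assms(6) by simp
  note f = run_find_entry[OF assms(5) v assms(7) m refl e8[unfolded e_def], folded e_def]
  show "regs (run w find_entry s) 0 = u" "regs (run w find_entry s) (Suc 0) = v"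
    "regs (run w find_entry s) 2 = Suc e" "regs (run w find_entry s) 7 = 1"
    "mem (run w find_entry s) = mem s" using f by simp_all
  show "regs (run w find_entry s) 3 = entry_word w stride en 0 mod 2 ^ w"
    using f(4) mem[of 0] by simp
qed

text \<open>There are \<open>m\<close> branches and one leaf. Each iteration costs its body and a
  test, and the last summand 1 is the failing test.\<close>

lemma search_loop:
  assumes "finds r u v a m" "stored table s"
    and "regs s 0 = u" "regs s 1 = v" "regs s 2 = r * stride" "regs s 3 \<noteq> 0"
  shows "\<exists>t s'. exec w (While 3 search_step) s t s' \<and> t \<le> (m + 1) * (cost search_step + 1) + 1 \<and>
    regs s' 0 = a \<and> mem s' = mem s"
  using assms
proof (induction arbitrary: s rule: finds.induct)
  case (leaf r u v a)
  note found = entry_found[OF leaf.prems(1) leaf.hyps(1-3) leaf.prems(2-4)]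
    and mem = entry_mem[OF leaf.prems(1) leaf.hyps(1-3) leaf.prems(2-4), unfolded leaf.hyps(4)]
  obtain t where t: "t \<le> cost search_step" "exec w search_step s t (run w search_step s)"
    using exec_run[OF loop_free_search_step] by blast
  have s': "regs (run w search_step s) 0 = a" "regs (run w search_step s) 3 = 0"
    "mem (run w search_step s) = mem s"
    using found mem[of 1] leaf.hyps(4,5) by (simp_all add: search_step_def)
  have "exec w (While 3 search_step) s (1 + t + 1) (run w search_step s)"
    using exec.While_true[where x = 3, OF leaf.prems(5) t(2) exec.While_false[OF s'(2)]] .
  moreover have "1 + t + 1 \<le> (0 + 1) * (cost search_step + 1) + 1" using t(1) by simp
  ultimately show ?case using s'(1,3) by blast
next
  case (branch r u v tu tv du1 dv1 r1 du2 dv2 r2 r' du dv a m)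
  note found = entry_found[OF branch.prems(1) branch.hyps(1-3) branch.prems(2-4)]
    and mem = entry_mem[OF branch.prems(1) branch.hyps(1-3) branch.prems(2-4), unfolded branch.hyps(4)]
    and small = entry_address[OF branch.prems(1) branch.hyps(1-3) branch.prems(2-4)]
  define e where "e = r * stride + 3 + 9 * (u div 2 ^ su r * 2 ^ k + v div 2 ^ sv r)"
  define s1 where "s1 = run w find_entry s"
  note found = found[folded e_def s1_def] and mem = mem[folded e_def] and small = small[folded e_def]
  have w: "w \<noteq> 0" using small by (intro notI) simp
  then have w1: "1 mod 2 ^ w = (1::nat)" by simp
  define f where "f = (if u < tu \<and> v < tv then e + 3 else e + 6)"
  have tmem: "mem s1 (Suc e) = tu" "mem s1 (Suc (Suc e)) = tv"
    using found(6) mem[of 1] mem[of 2] branch.hyps(5,6) by simp_all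
  \<comment> \<open>Only the target that is followed is known to be a region, from the remaining
    derivation; its address is therefore stored unreduced.\<close>
  have r': "r' * stride < 2 ^ w" using address_word[OF finds_region[OF branch.hyps(12)], of 0]
    by (simp add: stride_def)
  have fmem: "mem s1 f = nat (du mod 2 ^ w)" "mem s1 (Suc f) = nat (dv mod 2 ^ w)"
    "mem s1 (Suc (Suc f)) = r' * stride"
  proof -
    have nm: "nat (x mod 2 ^ w) mod 2 ^ w = nat (x mod 2 ^ w)" for x :: int
      by (intro mod_less) (simp add: nat_less_iff)
    show "mem s1 f = nat (du mod 2 ^ w)" using branch.hyps(7) found(6) mem[of 3] mem[of 6] nm
      by (auto simp: f_def split: if_splits)
    show "mem s1 (Suc f) = nat (dv mod 2 ^ w)" using branch.hyps(7) found(6) mem[of 4] mem[of 7] nm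
      by (auto simp: f_def eval_nat_numeral split: if_splits)
    show "mem s1 (Suc (Suc f)) = r' * stride" using branch.hyps(7) found(6) mem[of 5] mem[of 8] r'
      by (auto simp: f_def eval_nat_numeral split: if_splits)
  qed
  have "run w search_step s = run w follow_branch s1"
    using found(4) branch.hyps(4) w1 by (simp add: search_step_def s1_def[symmetric])
  moreover note run_follow_branch[OF found(1-3,5) small tmem f_def]
  ultimately have s': "regs (run w search_step s) 0 = nat (int u + du)"
    "regs (run w search_step s) 1 = nat (int v + dv)" "regs (run w search_step s) 2 = r' * stride"
    "regs (run w search_step s) 3 \<noteq> 0" "mem (run w search_step s) = mem s"
    using fmem found(4,6) w1 branch.hyps(4) word_add_offset branch.hyps(8-11) by simp_all
  have st: "stored table (run w search_step s)" using s'(5) branch.prems(1) by (simp add: stored_def)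
  obtain t where t: "t \<le> cost search_step" "exec w search_step s t (run w search_step s)"
    using exec_run[OF loop_free_search_step] by blast
  obtain t' s2 where t': "exec w (While 3 search_step) (run w search_step s) t' s2"
    "t' \<le> (m + 1) * (cost search_step + 1) + 1" "regs s2 0 = a" "mem s2 = mem (run w search_step s)"
    using branch.IH[OF st s'(1-4)] by blast
  have "exec w (While 3 search_step) s (1 + t + t') s2"
    using branch.prems(5) t(2) t'(1) by (rule exec.While_true)
  moreover have "1 + t + t' \<le> (Suc m + 1) * (cost search_step + 1) + 1" using t(1) t'(2) by simp
  moreover have "mem s2 = mem s" using t'(4) s'(5) by simp
  ultimately show ?case using t'(3) by blast
qed

lemma search_correct:
  assumes "finds 0 (i - 1) (j - 1) a m" "stored table s"
    and "regs s 0 = i" "regs s 1 = j" "1 \<le> i" "i < 2 ^ w" "1 \<le> j" "j < 2 ^ w"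
  shows "\<exists>t s'. exec w search s t s' \<and> t \<le> (m + 8) * (cost search_step + 1) \<and>
    regs s' 0 = a \<and> stored table s'"
proof -
  let ?init = "seqs [Const 4 1, Op 0 Sub 0 4, Op 1 Sub 1 4, Const 2 0, Const 3 1]"
  have w: "w \<noteq> 0" using assms(5,6) by (intro notI) simp
  have sub: "(x + (2 ^ w - Suc 0)) mod 2 ^ w = x - 1" if "1 \<le> x" "x < 2 ^ w" for x :: nat
  proof -
    have "(x + (2 ^ w - Suc 0)) mod 2 ^ w = ((x - 1) + 2 ^ w) mod 2 ^ w" using that by simp
    also have "\<dots> = x - 1" using that by (subst mod_add_self2) simp
    finally show ?thesis .
  qed
  have "loop_free ?init" "cost ?init = 6" by simp_all
  then obtain t where t: "t \<le> 6" "exec w ?init s t (run w ?init s)"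
    using exec_run by metis
  have j: "regs s (Suc 0) = j" using assms(4) by simp
  have s': "regs (run w ?init s) 0 = i - 1" "regs (run w ?init s) 1 = j - 1"
    "regs (run w ?init s) 2 = 0 * stride" "regs (run w ?init s) 3 \<noteq> 0" "mem (run w ?init s) = mem s"
    using sub[of i] sub[of j] w assms(3,5-8) j by simp_all
  have "stored table (run w ?init s)" using assms(2) s'(5) by (simp add: stored_def)
  then obtain u s2 where u: "exec w (While 3 search_step) (run w ?init s) u s2"
    "u \<le> (m + 1) * (cost search_step + 1) + 1" "regs s2 0 = a" "mem s2 = mem (run w ?init s)"
    using search_loop[OF assms(1) _ s'(1-4)] by blast
  have "exec w search s (t + u) s2" unfolding search_def using t(2) u(1) by (rule exec.Seq)
  \<comment> \<open>Initialisation takes 6 units and the last test 1; these are counted generously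
    as 7 more iterations.\<close>
  moreover have "t + u \<le> (m + 8) * (cost search_step + 1)" using t(1) u(2) by (simp add: algebra_simps)
  moreover have "stored table s2" using u(4) s'(5) assms(2) by (simp add: stored_def)
  ultimately show ?thesis using u(3) by blast
qed

end


section \<open>Corner regions\<close>

text \<open>The key \<open>(N, fr, fc, p, q)\<close> stands for the corner of the expansion of \<open>N\<close> with
  \<open>2 ^ (k * p)\<close> rows and \<open>2 ^ (k * q)\<close> columns; \<open>fr\<close> selects the lower and \<open>fc\<close> the right side.
  If the expansion is smaller than that, truncated subtraction puts the origin at 0.\<close>

type_synonym 'a key = "'a \<times> bool \<times> bool \<times> nat \<times> nat"

definition origin :: "bool \<Rightarrow> nat \<Rightarrow> nat \<Rightarrow> nat" where
  "origin f d z = (if f then d - z else 0)"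

text \<open>The registers hold \<open>u\<close> and \<open>v\<close>, the coordinates relative to
  the origin of the corner; \<open>i\<close> and \<open>j\<close> are those in the
  expansion.\<close>

fun located :: "'a slp2d \<Rightarrow> nat \<Rightarrow> nat \<Rightarrow> 'a key \<Rightarrow> nat \<Rightarrow> nat \<Rightarrow> 'a \<Rightarrow> bool" where
  "located G n k (N, fr, fc, p, q) u v a \<longleftrightarrow> (\<exists>M i j. expands G N M \<and>
     dim_row M \<le> n \<and> dim_col M \<le> n \<and> i < dim_row M \<and> j < dim_col M \<and> M $$ (i, j) = a \<and>
     i = origin fr (dim_row M) (2 ^ (k * p)) + u \<and> u < 2 ^ (k * p) \<and>
     j = origin fc (dim_col M) (2 ^ (k * q)) + v \<and> v < 2 ^ (k * q))"

text \<open>For \<open>p = 0\<close> the truncated \<open>p - 1\<close> gives blocks of one row,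
  which is right since the region itself then has one row; likewise for \<open>q\<close>.\<close>

fun in_block :: "nat \<Rightarrow> 'a key \<Rightarrow> nat \<Rightarrow> nat \<Rightarrow> nat \<Rightarrow> nat \<Rightarrow> bool" where
  "in_block k (N, fr, fc, p, q) bu bv u v \<longleftrightarrow>
     u div 2 ^ (k * (p - 1)) = bu \<and> v div 2 ^ (k * (q - 1)) = bv"

fun lower :: "'a slp2d \<Rightarrow> 'a key \<Rightarrow> 'a key \<Rightarrow> bool" where
  "lower G (N', fr', fc', p', q') (N, fr, fc, p, q) \<longleftrightarrow>
     N' \<in> nonterminals G \<and> p' \<le> p \<and> q' \<le> q \<and> p' + q' < p + q"

text \<open>Offsets are integers because the origin of the new corner may lie on either side of the
  old one.\<close>

definition moved ::
  "'a slp2d \<Rightarrow> nat \<Rightarrow> nat \<Rightarrow> 'a key \<Rightarrow> int \<Rightarrow> int \<Rightarrow> nat \<Rightarrow> nat \<Rightarrow> 'a \<Rightarrow> bool" where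
  "moved G n k \<kappa> du dv u v a \<longleftrightarrow> 0 \<le> int u + du \<and> 0 \<le> int v + dv \<and>
     located G n k \<kappa> (nat (int u + du)) (nat (int v + dv)) a"

text \<open>For the direction that is not split. A descendant ends no later than the whole
  expansion, so a point within \<open>z\<close> of the end of the whole is within \<open>z\<close>
  of the end of the descendant; similarly at the beginning.\<close>

lemma origin_keep:
  assumes "dr \<le> i" "i < dr + d'" "dr + d' \<le> d" "origin f d z \<le> i" "i < origin f d z + z"
  shows "origin f d' z \<le> i - dr" "i - dr < origin f d' z + z"
  using assms by (auto simp: origin_def split: if_splits)

text \<open>For the first child: the split line is its far end. The next lemma treats the second
  child, which begins at the split line.\<close>

lemma origin_far:
  assumes "dr \<le> i" "i < dr + d'" "dr + d' \<le> i + z"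
  shows "origin True d' z \<le> i - dr" "i - dr < origin True d' z + z"
  using assms by (auto simp: origin_def)

lemma origin_near:
  assumes "i < dr + z" "dr \<le> i"
  shows "origin False d' z \<le> i - dr" "i - dr < origin False d' z + z"
  using assms by (auto simp: origin_def)

text \<open>The offset is the old origin minus the position of the child minus the new origin inside
  the child. It is the same for all points, hence can be tabulated.\<close>

lemma moved_placed:
  assumes "expands G A X" "placed X M dr dc" "dim_row M \<le> n" "dim_col M \<le> n"
    and "dr \<le> i" "i < dr + dim_row X" "dc \<le> j" "j < dc + dim_col X" "M $$ (i, j) = a"
    and "i = br + u" "j = bc + v"
    and "origin fr (dim_row X) (2 ^ (k * p)) \<le> i - dr"
      "i - dr < origin fr (dim_row X) (2 ^ (k * p)) + 2 ^ (k * p)"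
    and "origin fc (dim_col X) (2 ^ (k * q)) \<le> j - dc"
      "j - dc < origin fc (dim_col X) (2 ^ (k * q)) + 2 ^ (k * q)"
  shows "moved G n k (A, fr, fc, p, q)
    (int br - int dr - int (origin fr (dim_row X) (2 ^ (k * p))))
    (int bc - int dc - int (origin fc (dim_col X) (2 ^ (k * q)))) u v a"
proof -
  let ?or = "origin fr (dim_row X) (2 ^ (k * p))" and ?oc = "origin fc (dim_col X) (2 ^ (k * q))"
  have u: "int u + (int br - int dr - int ?or) = int (i - dr - ?or)" using assms by simp
  have v: "int v + (int bc - int dc - int ?oc) = int (j - dc - ?oc)" using assms by simp
  have "X $$ (i - dr, j - dc) = a" using placed_index[OF assms(2,5-8)] assms(9) by simp
  then have "located G n k (A, fr, fc, p, q) (i - dr - ?or) (j - dc - ?oc) a"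
    unfolding located.simps
    by (intro exI[of _ X] exI[of _ "i - dr"] exI[of _ "j - dc"])
      (use assms in \<open>auto simp: placed_def\<close>)
  then show ?thesis unfolding moved_def u v by simp
qed

text \<open>The order of quantifiers is the point: thresholds, targets and offsets are chosen from
  region and block before \<open>u\<close> and \<open>v\<close> are known. A block without points
  falls under the first alternative.\<close>

lemma located_step:
  fixes G :: "'a slp2d"
  assumes "wf_slp2d G"
  shows "(\<exists>c. \<forall>u v a. located G n k \<kappa> u v a \<and> in_block k \<kappa> bu bv u v \<longrightarrow> a = c) \<or>
    (\<exists>tu tv \<kappa>1 du1 dv1 \<kappa>2 du2 dv2. tu \<le> n \<and> tv \<le> n \<and> lower G \<kappa>1 \<kappa> \<and> lower G \<kappa>2 \<kappa> \<and>
      (\<forall>u v a. located G n k \<kappa> u v a \<and> in_block k \<kappa> bu bv u v \<longrightarrow>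
         (if u < tu \<and> v < tv then moved G n k \<kappa>1 du1 dv1 u v a else moved G n k \<kappa>2 du2 dv2 u v a)))"
proof (cases "\<exists>u v a. located G n k \<kappa> u v a \<and> in_block k \<kappa> bu bv u v")
  case False
  then show ?thesis by blast
next
  case True
  obtain N fr fc p q where \<kappa>: "\<kappa> = (N, fr, fc, p, q)" by (cases \<kappa>)
  obtain u\<^sub>0 v\<^sub>0 a\<^sub>0 where pt: "located G n k \<kappa> u\<^sub>0 v\<^sub>0 a\<^sub>0" "in_block k \<kappa> bu bv u\<^sub>0 v\<^sub>0"
    using True by blast
  then obtain M where M: "expands G N M" "dim_row M \<le> n" "dim_col M \<le> n"
    unfolding \<kappa> located.simps by blast
  define br bc where "br = origin fr (dim_row M) (2 ^ (k * p))" and "bc = origin fc (dim_col M) (2 ^ (k * q))"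
  define zr zc :: nat where "zr = 2 ^ (k * (p - 1))" and "zc = 2 ^ (k * (q - 1))"
  \<comment> \<open>The region may exceed the expansion, so the block is clipped by
    \<open>min\<close>.\<close>
  define r0 r1 where "r0 = br + bu * zr" and "r1 = min (r0 + zr) (dim_row M)"
  define c0 c1 where "c0 = bc + bv * zc" and "c1 = min (c0 + zc) (dim_col M)"
  have block: "\<exists>i j. i = br + u \<and> j = bc + v \<and> u < 2 ^ (k * p) \<and> v < 2 ^ (k * q) \<and> M $$ (i, j) = a \<and>
      r0 \<le> i \<and> i < r1 \<and> c0 \<le> j \<and> j < c1"
    if loc: "located G n k \<kappa> u v a" and inb: "in_block k \<kappa> bu bv u v" for u v a
  proof -
    obtain M' i j where ij: "expands G N M'" "i < dim_row M'" "j < dim_col M'" "M' $$ (i, j) = a"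
      "i = origin fr (dim_row M') (2 ^ (k * p)) + u" "u < 2 ^ (k * p)"
      "j = origin fc (dim_col M') (2 ^ (k * q)) + v" "v < 2 ^ (k * q)"
      using loc unfolding \<kappa> located.simps by blast
    have M': "M' = M" using expands_unique[OF assms ij(1) M(1)] .
    have b: "u div zr = bu" "v div zc = bv" using inb by (simp_all add: \<kappa> zr_def zc_def)
    have z: "zr > 0" "zc > 0" by (simp_all add: zr_def zc_def)
    have "bu * zr \<le> u" "bv * zc \<le> v" using b by auto
    moreover have "u < bu * zr + zr" "v < bv * zc + zc"
      using dividend_less_div_times[OF z(1), of u] dividend_less_div_times[OF z(2), of v] b
      by (simp_all add: add.commute)
    ultimately show ?thesis using ij unfolding M' br_def[symmetric] bc_def[symmetric]
      by (simp add: r0_def r1_def c0_def c1_def)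
  qed
  have "r0 < r1" "c0 < c1" using block[OF pt] by auto
  then have "cut_rows G M r0 r1 c0 c1 \<or> cut_cols G M r0 r1 c0 c1 \<or> constant_on M r0 r1 c0 c1"
    using expands_cut_or_constant[OF M(1)] by (simp add: r1_def c1_def)
  then consider "cut_rows G M r0 r1 c0 c1" | "cut_cols G M r0 r1 c0 c1" | "constant_on M r0 r1 c0 c1"
    by blast
  then show ?thesis
  proof cases
    case 3
    then obtain c where c: "\<And>i j. r0 \<le> i \<Longrightarrow> i < r1 \<Longrightarrow> c0 \<le> j \<Longrightarrow> j < c1 \<Longrightarrow> M $$ (i, j) = c"
      unfolding constant_on_def by blast
    have "a = c" if "located G n k \<kappa> u v a" "in_block k \<kappa> bu bv u v" for u v a
      using block[OF that] c by blast
    then show ?thesis by blast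
  next
    case 1
    then obtain A B X Y dr dc where X: "expands G A X" and Y: "expands G B Y"
      and pX: "placed X M dr dc" and pY: "placed Y M (dr + dim_row X) dc" and eq: "dim_col X = dim_col Y"
      and r: "dr \<le> r0" "r0 < dr + dim_row X" "dr + dim_row X < r1" "r1 \<le> dr + dim_row X + dim_row Y"
      and c: "dc \<le> c0" "c1 \<le> dc + dim_col X"
      unfolding cut_rows_def by blast
    have r1: "r1 \<le> r0 + zr" "r1 \<le> dim_row M" by (simp_all add: r1_def)
    \<comment> \<open>The split line lies strictly inside the block, which thus has at least two
      rows. This rules out \<open>p = 0\<close>, so \<open>p - 1\<close> is a genuine
      decrease.\<close>
    have "zr \<noteq> 1" using r r1 by auto
    then have p: "p \<ge> 1" by (cases p) (auto simp: zr_def)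
    \<comment> \<open>The row threshold is the split line counted from the old origin. The column
      threshold \<open>n\<close> always passes, so one form of test serves both directions.\<close>
    have "dr + dim_row X - br \<le> n" using r r1 M(2) by simp
    moreover have "n \<le> n" ..
    \<comment> \<open>The split line is the lower side of \<open>A\<close> and the upper side of
      \<open>B\<close>, whence the two flags.\<close>
    moreover have "lower G (A, True, fc, p - 1, q) \<kappa>" "lower G (B, False, fc, p - 1, q) \<kappa>"
      using expands_nonterminal[OF X] expands_nonterminal[OF Y] p by (simp_all add: \<kappa>)
    moreover have "if u < dr + dim_row X - br \<and> v < n
      then moved G n k (A, True, fc, p - 1, q) (int br - int dr - int (origin True (dim_row X) zr))
        (int bc - int dc - int (origin fc (dim_col X) (2 ^ (k * q)))) u v a
      else moved G n k (B, False, fc, p - 1, q)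
        (int br - int (dr + dim_row X) - int (origin False (dim_row Y) zr))
        (int bc - int dc - int (origin fc (dim_col Y) (2 ^ (k * q)))) u v a"
      if uv: "located G n k \<kappa> u v a" "in_block k \<kappa> bu bv u v" for u v a
    proof -
      obtain i j where ij: "i = br + u" "j = bc + v" "v < 2 ^ (k * q)" "M $$ (i, j) = a"
        "r0 \<le> i" "i < r1" "c0 \<le> j" "j < c1" using block[OF uv] by blast
      have dims: "dc + dim_col X \<le> dim_col M" using pX by (simp add: placed_def)
      have v: "v < n" using ij c dims M(3) by simp
      \<comment> \<open>Truncated subtraction is exact here, as \<open>br\<close> is at most
        \<open>r0\<close>, which lies above the split line.\<close>
      have test: "u < dr + dim_row X - br \<longleftrightarrow> i < dr + dim_row X" using ij r by (simp add: r0_def) linarith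
      have j: "dc \<le> j" "j < dc + dim_col X" using ij c by auto
      have keep: "origin fc (dim_col X) (2 ^ (k * q)) \<le> j - dc"
        "j - dc < origin fc (dim_col X) (2 ^ (k * q)) + 2 ^ (k * q)"
        using origin_keep[OF j dims, of fc "2 ^ (k * q)"] ij(2,3) by (simp_all add: bc_def)
      show ?thesis
      proof (cases "i < dr + dim_row X")
        case True
        have "dr \<le> i" "dr + dim_row X \<le> i + zr" using ij r r1 by auto
        note far = origin_far[OF this(1) True this(2)]
        show ?thesis using True v test
          moved_placed[OF X pX M(2,3) \<open>dr \<le> i\<close> True j ij(4,1,2) far[unfolded zr_def] keep]
          by (simp add: zr_def)
      next
        case False
        have i: "dr + dim_row X \<le> i" "i < dr + dim_row X + dim_row Y" "i < dr + dim_row X + zr"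
          using False ij r r1 by auto
        note near = origin_near[OF i(3,1), of "dim_row Y"]
        show ?thesis using False test
          moved_placed[OF Y pY M(2,3) i(1,2) j[unfolded eq] ij(4,1,2) near[unfolded zr_def] keep[unfolded eq]]
          by (simp add: zr_def)
      qed
    qed
    ultimately show ?thesis by blast
  next
    \<comment> \<open>The same argument with rows and columns exchanged.\<close>
    case 2
    then obtain A B X Y dr dc where X: "expands G A X" and Y: "expands G B Y"
      and pX: "placed X M dr dc" and pY: "placed Y M dr (dc + dim_col X)" and eq: "dim_row X = dim_row Y"
      and c: "dc \<le> c0" "c0 < dc + dim_col X" "dc + dim_col X < c1" "c1 \<le> dc + dim_col X + dim_col Y"
      and r: "dr \<le> r0" "r1 \<le> dr + dim_row X"
      unfolding cut_cols_def by blast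
    have c1: "c1 \<le> c0 + zc" "c1 \<le> dim_col M" by (simp_all add: c1_def)
    have "zc \<noteq> 1" using c c1 by auto
    then have q: "q \<ge> 1" by (cases q) (auto simp: zc_def)
    have "n \<le> n" ..
    moreover have "dc + dim_col X - bc \<le> n" using c c1 M(3) by simp
    moreover have "lower G (A, fr, True, p, q - 1) \<kappa>" "lower G (B, fr, False, p, q - 1) \<kappa>"
      using expands_nonterminal[OF X] expands_nonterminal[OF Y] q by (simp_all add: \<kappa>)
    moreover have "if u < n \<and> v < dc + dim_col X - bc
      then moved G n k (A, fr, True, p, q - 1)
        (int br - int dr - int (origin fr (dim_row X) (2 ^ (k * p))))
        (int bc - int dc - int (origin True (dim_col X) zc)) u v a
      else moved G n k (B, fr, False, p, q - 1)
        (int br - int dr - int (origin fr (dim_row Y) (2 ^ (k * p))))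
        (int bc - int (dc + dim_col X) - int (origin False (dim_col Y) zc)) u v a"
      if uv: "located G n k \<kappa> u v a" "in_block k \<kappa> bu bv u v" for u v a
    proof -
      obtain i j where ij: "i = br + u" "j = bc + v" "u < 2 ^ (k * p)" "M $$ (i, j) = a"
        "r0 \<le> i" "i < r1" "c0 \<le> j" "j < c1" using block[OF uv] by blast
      have dims: "dr + dim_row X \<le> dim_row M" using pX by (simp add: placed_def)
      have u: "u < n" using ij r dims M(2) by simp
      have test: "v < dc + dim_col X - bc \<longleftrightarrow> j < dc + dim_col X" using ij c by (simp add: c0_def) linarith
      have i: "dr \<le> i" "i < dr + dim_row X" using ij r by auto
      have keep: "origin fr (dim_row X) (2 ^ (k * p)) \<le> i - dr"
        "i - dr < origin fr (dim_row X) (2 ^ (k * p)) + 2 ^ (k * p)"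
        using origin_keep[OF i dims, of fr "2 ^ (k * p)"] ij(1,3) by (simp_all add: br_def)
      show ?thesis
      proof (cases "j < dc + dim_col X")
        case True
        have "dc \<le> j" "dc + dim_col X \<le> j + zc" using ij c c1 by auto
        note far = origin_far[OF this(1) True this(2)]
        show ?thesis using True u test
          moved_placed[OF X pX M(2,3) i \<open>dc \<le> j\<close> True ij(4,1,2) keep far[unfolded zc_def]]
          by (simp add: zc_def)
      next
        case False
        have j: "dc + dim_col X \<le> j" "j < dc + dim_col X + dim_col Y" "j < dc + dim_col X + zc"
          using False ij c c1 by auto
        note near = origin_near[OF j(3,1), of "dim_col Y"]
        show ?thesis using False test
          moved_placed[OF Y pY M(2,3) i[unfolded eq] j(1,2) ij(4,1,2) keep[unfolded eq] near[unfolded zc_def]]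
          by (simp add: zc_def)
      qed
    qed
    ultimately show ?thesis by blast
  qed
qed

section \<open>Tables for all corner regions\<close>

fun entry_spec :: "'a slp2d \<Rightarrow> nat \<Rightarrow> nat \<Rightarrow> ('a \<Rightarrow> nat) \<Rightarrow> 'a key list \<Rightarrow> 'a key \<Rightarrow> nat \<Rightarrow> nat \<Rightarrow>
    entry \<Rightarrow> bool" where
  "entry_spec G n k code ks \<kappa> bu bv (Leaf c) \<longleftrightarrow>
     (\<forall>u v a. located G n k \<kappa> u v a \<and> in_block k \<kappa> bu bv u v \<longrightarrow> c = code a)"
| "entry_spec G n k code ks \<kappa> bu bv (Branch tu tv du1 dv1 r1 du2 dv2 r2) \<longleftrightarrow>
     tu \<le> n \<and> tv \<le> n \<and> r1 < length ks \<and> r2 < length ks \<and>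
     lower G (ks ! r1) \<kappa> \<and> lower G (ks ! r2) \<kappa> \<and>
     (\<forall>u v a. located G n k \<kappa> u v a \<and> in_block k \<kappa> bu bv u v \<longrightarrow>
        (if u < tu \<and> v < tv then moved G n k (ks ! r1) du1 dv1 u v a
         else moved G n k (ks ! r2) du2 dv2 u v a))"

definition keys :: "'a slp2d \<Rightarrow> nat \<Rightarrow> 'a key set" where
  "keys G L = nonterminals G \<times> UNIV \<times> UNIV \<times> {..L} \<times> {..L}"

text \<open>Closure of the finite set of keys, so every branch leads to a region that has a
  table.\<close>

lemma lower_keys: "lower G \<kappa>' \<kappa> \<Longrightarrow> \<kappa> \<in> keys G L \<Longrightarrow> \<kappa>' \<in> keys G L"
  by (cases \<kappa>; cases \<kappa>') (auto simp: keys_def)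

lemma entry_exists:
  assumes "wf_slp2d G" "keys G L \<subseteq> set ks" "\<kappa> \<in> keys G L"
  shows "\<exists>e. entry_spec G n k code ks \<kappa> bu bv e"
  using located_step[OF assms(1), of n k \<kappa> bu bv]
proof (elim disjE exE conjE)
  fix c assume "\<forall>u v a. located G n k \<kappa> u v a \<and> in_block k \<kappa> bu bv u v \<longrightarrow> a = c"
  then have "entry_spec G n k code ks \<kappa> bu bv (Leaf (code c))" by auto
  then show ?thesis ..
next
  fix tu tv \<kappa>1 du1 dv1 \<kappa>2 du2 dv2
  assume *: "tu \<le> n" "tv \<le> n" "lower G \<kappa>1 \<kappa>" "lower G \<kappa>2 \<kappa>"
    "\<forall>u v a. located G n k \<kappa> u v a \<and> in_block k \<kappa> bu bv u v \<longrightarrow>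
         (if u < tu \<and> v < tv then moved G n k \<kappa>1 du1 dv1 u v a else moved G n k \<kappa>2 du2 dv2 u v a)"
  have "\<kappa>1 \<in> set ks" "\<kappa>2 \<in> set ks" using lower_keys[OF *(3) assms(3)] lower_keys[OF *(4) assms(3)] assms(2)
    by auto
  then obtain r1 r2 where "r1 < length ks" "ks ! r1 = \<kappa>1" "r2 < length ks" "ks ! r2 = \<kappa>2"
    by (auto simp: in_set_conv_nth)
  then have "entry_spec G n k code ks \<kappa> bu bv (Branch tu tv du1 dv1 r1 du2 dv2 r2)" using * by simp
  then show ?thesis ..
qed

lemma block_index_bound:
  assumes "u < 2 ^ (k * p)"
  shows "u div 2 ^ (k * (p - 1)) < (2::nat) ^ k"
proof (cases p)
  case 0
  then show ?thesis using assms by simp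
next
  case (Suc p')
  then have "u < 2 ^ k * 2 ^ (k * p')" using assms by (simp add: power_add)
  then show ?thesis using Suc by (simp add: less_mult_imp_div_less)
qed

fun key_level :: "'a key \<Rightarrow> nat" where
  "key_level (N, fr, fc, p, q) = p + q"

lemma lower_level: "lower G \<kappa>' \<kappa> \<Longrightarrow> key_level \<kappa>' < key_level \<kappa>"
  by (cases \<kappa>; cases \<kappa>') auto

definition row_shift :: "nat \<Rightarrow> 'a key \<Rightarrow> nat" where
  "row_shift k \<kappa> = (case \<kappa> of (N, fr, fc, p, q) \<Rightarrow> k * (p - 1))"

definition col_shift :: "nat \<Rightarrow> 'a key \<Rightarrow> nat" where
  "col_shift k \<kappa> = (case \<kappa> of (N, fr, fc, p, q) \<Rightarrow> k * (q - 1))"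

lemma in_block_shift: "in_block k \<kappa> (u div 2 ^ row_shift k \<kappa>) (v div 2 ^ col_shift k \<kappa>) u v"
  by (cases \<kappa>) (simp add: row_shift_def col_shift_def)

lemma located_bounds:
  assumes "located G n k \<kappa> u v a"
  shows "u < n" "v < n" "u div 2 ^ row_shift k \<kappa> < 2 ^ k" "v div 2 ^ col_shift k \<kappa> < 2 ^ k"
  using assms block_index_bound by (cases \<kappa>; auto simp: row_shift_def col_shift_def)+

lemma located_alphabet:
  assumes "located G n k \<kappa> u v a" "wf_slp2d G"
  shows "a \<in> alphabet G"
  using assms expands_entry_alphabet by (cases \<kappa>) auto

text \<open>Every branch lowers \<open>p + q\<close>, which bounds the length of the search.
  Relative coordinates stay below \<open>n\<close>, hence nothing overflows on the way.\<close>

lemma located_finds: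
  fixes ks :: "'a key list"
  assumes "block_tables w k (length ks) (\<lambda>r. row_shift k (ks ! r)) (\<lambda>r. col_shift k (ks ! r))"
    and "wf_slp2d G" and "n < 2 ^ w" and code: "\<And>a. a \<in> alphabet G \<Longrightarrow> code a < 2 ^ w"
    and ent: "\<And>r bu bv. r < length ks \<Longrightarrow> entry_spec G n k code ks (ks ! r) bu bv (ent r bu bv)"
    and "r < length ks" "located G n k (ks ! r) u v a"
  shows "\<exists>m \<le> key_level (ks ! r). block_tables.finds w k (length ks)
    (\<lambda>r. row_shift k (ks ! r)) (\<lambda>r. col_shift k (ks ! r)) ent r u v (code a) m"
  using assms(6,7)
proof (induction "key_level (ks ! r)" arbitrary: r u v rule: less_induct)
  case less
  interpret block_tables w k "length ks" "\<lambda>r. row_shift k (ks ! r)" "\<lambda>r. col_shift k (ks ! r)" ent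
    by (rule assms(1))
  note b = located_bounds[OF less.prems(2)]
  let ?\<kappa> = "ks ! r"
  let ?bu = "u div 2 ^ row_shift k ?\<kappa>" and ?bv = "v div 2 ^ col_shift k ?\<kappa>"
  note spec = ent[OF less.prems(1), of ?bu ?bv]
  show ?case
  proof (cases "ent r ?bu ?bv")
    case (Leaf c)
    then have "c = code a" using spec less.prems(2) in_block_shift[of k ?\<kappa> u v] by auto
    moreover have "code a < 2 ^ w" using code located_alphabet[OF less.prems(2) assms(2)] .
    ultimately have "finds r u v (code a) 0" using Leaf b less.prems(1) by (intro finds.leaf) auto
    then show ?thesis by blast
  next
    case (Branch tu tv du1 dv1 r1 du2 dv2 r2)
    obtain r' du dv where sel: "(r', du, dv) = (if u < tu \<and> v < tv then (r1, du1, dv1) else (r2, du2, dv2))"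
      by (metis surj_pair)
    have mv: "if u < tu \<and> v < tv then moved G n k (ks ! r1) du1 dv1 u v a
        else moved G n k (ks ! r2) du2 dv2 u v a"
      using spec less.prems(2) in_block_shift[of k ?\<kappa> u v] unfolding Branch by auto
    have t: "tu \<le> n" "tv \<le> n" "r' < length ks" "lower G (ks ! r') ?\<kappa>" "moved G n k (ks ! r') du dv u v a"
      using spec mv sel unfolding Branch by (auto split: if_splits)
    from t(5) have m: "0 \<le> int u + du" "0 \<le> int v + dv"
      "located G n k (ks ! r') (nat (int u + du)) (nat (int v + dv)) a" by (simp_all add: moved_def)
    note lev = lower_level[OF t(4)]
    obtain m' where m': "m' \<le> key_level (ks ! r')"
      "finds r' (nat (int u + du)) (nat (int v + dv)) (code a) m'"
      using less.hyps[OF lev t(3) m(3)] by blast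
    have "nat (int u + du) < 2 ^ w" "nat (int v + dv) < 2 ^ w"
      using less_trans[OF located_bounds(1)[OF m(3)] assms(3)]
        less_trans[OF located_bounds(2)[OF m(3)] assms(3)] .
    then have "int u + du < 2 ^ w" "int v + dv < 2 ^ w" by (simp_all add: nat_less_iff m)
    then have "finds r u v (code a) (Suc m')"
      using less.prems(1) b Branch t(1,2) assms(3) sel m m'(2) by (intro finds.branch) auto
    then show ?thesis using m'(1) lev by (intro exI[of _ "Suc m'"]) simp
  qed
qed

text \<open>\<open>R\<close> counts four corners of each nonterminal for every pair of exponents up
  to \<open>L\<close>, and the root once more. The root has level \<open>2 * L\<close>, which bounds
  the number of branches.\<close>

lemma access_structure:
  fixes G :: "'a slp2d"
  assumes wf: "wf_slp2d G" and T: "represents G T" "dim_row T \<le> n" "dim_col T \<le> n"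
    and n: "n \<le> 2 ^ (k * L)" "n < 2 ^ w"
    and code: "\<And>a. a \<in> alphabet G \<Longrightarrow> code a < 2 ^ w"
    and R: "R = 1 + 4 * card (nonterminals G) * (L + 1)\<^sup>2" and fits: "R * (3 + 9 * 4 ^ k) \<le> 2 ^ w"
  shows "\<exists>D. (\<forall>x \<in> set D. x < 2 ^ w) \<and> length D = R * (3 + 9 * 4 ^ k) \<and>
    answers_access w search D code T (real ((2 * L + 8) * (cost search_step + 1)))"
proof -
  have fin: "finite (nonterminals G)" using wf by (simp add: wf_slp2d_def nonterminals_def)
  have S: "start G \<in> nonterminals G" using wf by (simp add: wf_slp2d_def)
  define root :: "'a key" where "root = (start G, False, False, L, L)"
  have "finite (keys G L)" using fin by (simp add: keys_def)
  then obtain ks' where ks': "set ks' = keys G L" "length ks' = card (keys G L)"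
    using finite_distinct_list distinct_card by metis
  \<comment> \<open>The repeated root gets index 0, hence address 0. As \<open>n\<close> is at most
    \<open>2 ^ (k * L)\<close>, its corner is the whole of \<open>T\<close>.\<close>
  define ks where "ks = root # ks'"
  have root: "root \<in> keys G L" using S by (simp add: root_def keys_def)
  have set: "set ks = keys G L" using ks' root by (auto simp: ks_def)
  have len: "length ks = R"
    using ks' by (simp add: ks_def R keys_def card_cartesian_product card_UNIV_bool power2_eq_square)
  have "1 \<le> card (nonterminals G)" using fin S by (simp add: Suc_le_eq card_gt_0_iff) blast
  \<comment> \<open>Bounds all shifts: \<open>k\<close> is less than the length of a table and
    \<open>L\<close> less than the number of tables, so the product is below the total size.\<close>
  have "k * L < 2 ^ w"
  proof -
    have "L < R"
    proof -
      have "L < 1 * (L + 1)" by simp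
      also have "\<dots> \<le> (4 * card (nonterminals G) * (L + 1)) * (L + 1)"
        using \<open>1 \<le> card (nonterminals G)\<close> by (intro mult_right_mono) auto
      finally show ?thesis by (simp add: R power2_eq_square algebra_simps)
    qed
    have "k < 2 ^ k" by simp
    also have "(2::nat) ^ k \<le> 4 ^ k" by (simp add: power_mono)
    finally have "k < 3 + 9 * 4 ^ k" by simp
    then have "k * L < (3 + 9 * 4 ^ k) * R" using \<open>L < R\<close> by (intro mult_strict_mono) auto
    then show ?thesis using fits by (simp add: mult.commute)
  qed
  have key: "ks ! r \<in> keys G L" if "r < R" for r using that set len nth_mem by blast
  have shifts: "row_shift k (ks ! r) < 2 ^ w" "col_shift k (ks ! r) < 2 ^ w" if r: "r < R" for r
  proof -
    obtain N fr fc p q where pq: "ks ! r = (N, fr, fc, p, q)" "p \<le> L" "q \<le> L"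
      using key[OF r] by (cases "ks ! r") (auto simp: keys_def)
    have "k * (p - 1) \<le> k * L" "k * (q - 1) \<le> k * L" using pq by auto
    then have "k * (p - 1) < 2 ^ w" "k * (q - 1) < 2 ^ w"
      using \<open>k * L < 2 ^ w\<close> by (blast intro: le_less_trans)+
    then show "row_shift k (ks ! r) < 2 ^ w" "col_shift k (ks ! r) < 2 ^ w"
      using pq by (simp_all add: row_shift_def col_shift_def)
  qed
  have bt: "block_tables w k (length ks) (\<lambda>r. row_shift k (ks ! r)) (\<lambda>r. col_shift k (ks ! r))"
    by unfold_locales (use fits shifts len in auto)
  have "\<forall>r bu bv. \<exists>e. r < R \<longrightarrow> entry_spec G n k code ks (ks ! r) bu bv e"
    using entry_exists[OF wf _ key] set by blast
  then obtain ent where ent: "\<And>r bu bv. r < R \<Longrightarrow> entry_spec G n k code ks (ks ! r) bu bv (ent r bu bv)"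
    by metis
  interpret block_tables w k "length ks" "\<lambda>r. row_shift k (ks ! r)" "\<lambda>r. col_shift k (ks ! r)" ent
    by (rule bt)
  have "answers_access w search table code T (real ((2 * L + 8) * (cost search_step + 1)))"
    unfolding answers_access_def
  proof (intro ballI allI impI, elim conjE)
    fix i j s
    assume ij: "i \<in> {1..dim_row T}" "j \<in> {1..dim_col T}" and s: "stored table s" "regs s 0 = i" "regs s 1 = j"
    have "located G n k (ks ! 0) (i - 1) (j - 1) (T $$ (i - 1, j - 1))"
      using T ij n(1) by (auto simp: ks_def root_def represents_def origin_def)
    moreover have "0 < length ks" by (simp add: ks_def)
    ultimately obtain m where m: "m \<le> key_level (ks ! 0)"
      "finds 0 (i - 1) (j - 1) (code (T $$ (i - 1, j - 1))) m"
      using located_finds[OF bt wf n(2), where code = code and ent = ent and r = 0] code ent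
      unfolding len by blast
    have lim: "1 \<le> i" "i < 2 ^ w" "1 \<le> j" "j < 2 ^ w" using ij T n(2) by auto
    obtain t s' where t: "exec w search s t s'" "t \<le> (m + 8) * (cost search_step + 1)"
      "regs s' 0 = code (T $$ (i - 1, j - 1))" "stored table s'"
      using search_correct[OF m(2) s lim] by blast
    have "m \<le> 2 * L" using m(1) by (simp add: ks_def root_def)
    then have "(m + 8) * (cost search_step + 1) \<le> (2 * L + 8) * (cost search_step + 1)"
      by (intro mult_right_mono) auto
    then have "real t \<le> real ((2 * L + 8) * (cost search_step + 1))" using t(2) by linarith
    then show "\<exists>t s'. exec w search s t s' \<and> real t \<le> real ((2 * L + 8) * (cost search_step + 1)) \<and>
        regs s' 0 = code (T $$ (i - 1, j - 1)) \<and> stored table s'"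
      using t by blast
  qed
  moreover have "length table = R * (3 + 9 * 4 ^ k)" using length_table len by (simp add: stride_def)
  ultimately show ?thesis using table_bound by blast
qed


section \<open>Choice of the block size\<close>

lemma lg_ge_1: "lg x \<ge> 1"
  by (simp add: lg_def)

lemma two_powr_lg: "x \<ge> 1 \<Longrightarrow> 2 powr lg x = max 2 x"
  by (auto simp: lg_def max_def not_le le_log_iff log_le_iff)

text \<open>Gives \<open>lg x / lg (lg x)\<close> at least 1 later, which absorbs additive constants
  in the time bound.\<close>

lemma lg_le_self:
  assumes "x \<ge> 1"
  shows "lg x \<le> x"
proof -
  have "x \<le> real (nat \<lfloor>x\<rfloor> + 1)" using assms by linarith
  also have "\<dots> \<le> real (2 ^ nat \<lfloor>x\<rfloor>)" unfolding of_nat_le_iff by (simp add: Suc_le_eq)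
  also have "\<dots> = 2 powr real (nat \<lfloor>x\<rfloor>)" by (simp add: powr_realpow)
  also have "\<dots> \<le> 2 powr x" using assms by simp
  finally have "x \<le> 2 powr x" .
  then show ?thesis using assms by (simp add: lg_def log_le_iff)
qed

theorem theorem1p1:
  fixes \<epsilon> :: real
  assumes "\<epsilon> > 0"
  shows "\<exists>(P :: com) (C\<^sub>1 :: real) (C\<^sub>2 :: real). C\<^sub>1 > 0 \<and> C\<^sub>2 > 0 \<and>
    (\<forall>(G :: 'a slp2d) (T :: 'a mat) (r :: nat) (c :: nat) (n :: nat) (g :: nat)
        (code :: 'a \<Rightarrow> nat) (w :: nat).
       wf_slp2d G \<and> slp2d_size G = g \<and>
       represents G T \<and> T \<in> carrier_mat r c \<and> n = max r c \<and>
       inj_on code (alphabet G) \<and> (\<forall>a \<in> alphabet G. code a < 2 ^ w) \<and>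
       n < 2 ^ w \<and> C\<^sub>1 * real g * lg (real n) powr (2 + \<epsilon>) \<le> 2 ^ w \<longrightarrow>
       (\<exists>D :: nat list.
          (\<forall>x \<in> set D. x < 2 ^ w) \<and>
          real (length D) \<le> C\<^sub>1 * real g * lg (real n) powr (2 + \<epsilon>) \<and>
          answers_access w P D code T (C\<^sub>2 * (lg (real n) / lg (lg (real n))))))"
proof -
  define c' where "c' = cost search_step + 1"
  \<comment> \<open>2160 is 45 * 12 * 4: 45 from the number of regions, 12 from 3 + 9 words, and 4
    from the bound on \<open>4 ^ k\<close>.\<close>
  define C1 where "C1 = 2160 * 2 powr \<epsilon>"
  \<comment> \<open>\<open>2 * L + 8\<close> is at most \<open>2 * (x / k) + 10\<close>, and
    \<open>k\<close> is at least \<open>\<epsilon> / 4 * y\<close>.\<close>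
  define C2 where "C2 = (8 / \<epsilon> + 10) * real c'"
  have C: "C1 > 0" "C2 > 0" using assms by (simp_all add: C1_def C2_def c'_def add_pos_nonneg)
  have main: "\<exists>D :: nat list. (\<forall>x \<in> set D. x < 2 ^ w) \<and>
      real (length D) \<le> C1 * real g * lg (real n) powr (2 + \<epsilon>) \<and>
      answers_access w search D code T (C2 * (lg (real n) / lg (lg (real n))))"
    if wf: "wf_slp2d G" and g: "slp2d_size G = g" and T: "represents G T" "T \<in> carrier_mat r c"
      and n: "n = max r c" and code: "\<forall>a \<in> alphabet G. code a < 2 ^ w"
      and nw: "n < 2 ^ w" and fits: "C1 * real g * lg (real n) powr (2 + \<epsilon>) \<le> 2 ^ w"
    for G :: "'a slp2d" and T :: "'a mat" and r c n g :: nat and code :: "'a \<Rightarrow> nat" and w :: nat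
  proof -
    define x where "x = lg (real n)"
    define y where "y = lg x"
    \<comment> \<open>This makes \<open>4 ^ k\<close> of order \<open>x powr \<epsilon>\<close>; the
      maximum with 1 covers small \<open>n\<close>.\<close>
    define k where "k = max 1 (nat \<lfloor>\<epsilon> / 2 * y\<rfloor>)"
    define L where "L = nat \<lceil>x / real k\<rceil>"
    define R where "R = 1 + 4 * card (nonterminals G) * (L + 1)\<^sup>2"
    have xy: "x \<ge> 1" "y \<ge> 1" "y \<le> x" using lg_ge_1 lg_le_self by (simp_all add: x_def y_def)
    have k1: "k \<ge> 1" by (simp add: k_def)
    \<comment> \<open>Rounding down at most halves a number that is at least 1; below 2 the value 1
      already suffices.\<close>
    have ky: "\<epsilon> / 4 * y \<le> real k"
      unfolding k_def using assms xy by (simp add: max_def) linarith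
    have four: "4 ^ k \<le> 4 * 2 powr \<epsilon> * x powr \<epsilon>"
    proof (cases "k = 1")
      case True
      have "1 * 1 \<le> 2 powr \<epsilon> * x powr \<epsilon>"
        using assms xy by (intro mult_mono) (auto intro: ge_one_powr_ge_zero)
      then show ?thesis using True by simp
    next
      case False
      then have "real k = real_of_int \<lfloor>\<epsilon> / 2 * y\<rfloor>" by (auto simp: k_def max_def split: if_splits)
      then have "real k \<le> \<epsilon> / 2 * y" by linarith
      then have k2: "2 * real k \<le> y * \<epsilon>" by (simp add: mult.commute)
      have "(4::real) ^ k = 2 powr (2 * real k)"
        by (simp add: powr_realpow[symmetric] powr_powr[symmetric])
      also have "\<dots> \<le> 2 powr (y * \<epsilon>)" using k2 by simp
      also have "\<dots> = (max 2 x) powr \<epsilon>" using xy by (simp add: powr_powr[symmetric] y_def two_powr_lg)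
      also have "\<dots> \<le> (2 * x) powr \<epsilon>" using xy assms by (intro powr_mono2) auto
      also have "\<dots> = 2 powr \<epsilon> * x powr \<epsilon>" using xy by (simp add: powr_mult)
      also have "\<dots> \<le> 4 * 2 powr \<epsilon> * x powr \<epsilon>" by simp
      finally show ?thesis .
    qed
    have L: "x / real k \<le> real L" "real L \<le> x / real k + 1"
      using xy k1 unfolding L_def by (simp_all add: of_nat_ceiling)
    have "real n \<le> 2 powr x" using two_powr_lg[of "real n"] by (cases "n = 0") (simp_all add: x_def)
    also have "\<dots> \<le> 2 powr (real k * real L)" using L(1) k1 by (simp add: field_simps)
    also have "\<dots> = real (2 ^ (k * L))" by (simp flip: powr_realpow)
    finally have n2: "n \<le> 2 ^ (k * L)" by simp
    have fin: "finite (nonterminals G)" using wf by (simp add: wf_slp2d_def nonterminals_def)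
    have "card (nonterminals G) = (\<Sum>N \<in> nonterminals G. 1)" by simp
    also have "\<dots> \<le> g" unfolding g[symmetric] slp2d_size_def by (intro sum_mono) simp
    finally have card: "card (nonterminals G) \<le> g" .
    have "card (nonterminals G) > 0" using fin wf by (auto simp: card_gt_0_iff wf_slp2d_def)
    then have g1: "g \<ge> 1" using card by simp
    have L3: "real L + 1 \<le> 3 * x"
    proof -
      have "x / real k \<le> x / 1" using xy k1 by (intro divide_left_mono) auto
      then show ?thesis using L(2) xy by simp
    qed
    \<comment> \<open>Four corners times \<open>(3 * x)\<close> squared give 36, and the additional
      root is absorbed by another 9.\<close>
    have R: "real R \<le> 45 * real g * x\<^sup>2"
    proof -
      have sq: "(real L + 1)\<^sup>2 \<le> (3 * x)\<^sup>2" using L3 by (intro power_mono) auto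
      have "1 \<le> (3 * x)\<^sup>2" using xy by (intro one_le_power) simp
      then have "1 * 1 \<le> real g * (3 * x)\<^sup>2" using g1 by (intro mult_mono) auto
      moreover have "real (card (nonterminals G)) * (real L + 1)\<^sup>2 \<le> real g * (3 * x)\<^sup>2"
        using card sq by (intro mult_mono) auto
      ultimately show ?thesis
        by (simp add: R_def power_mult_distrib add.commute[of 1 "real L"] mult.assoc)
    qed
    have "real (R * (3 + 9 * 4 ^ k)) = real R * (3 + 9 * 4 ^ k)" by simp
    also have "\<dots> \<le> (45 * real g * x\<^sup>2) * (12 * (4 * 2 powr \<epsilon> * x powr \<epsilon>))"
    proof (intro mult_mono R)
      have "1 \<le> (4::real) ^ k" by simp
      then show "3 + 9 * 4 ^ k \<le> 12 * (4 * 2 powr \<epsilon> * x powr \<epsilon>)" using four by linarith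
    qed auto
    also have "\<dots> = C1 * real g * x powr (2 + \<epsilon>)" using xy by (simp add: C1_def powr_add)
    finally have len: "real (R * (3 + 9 * 4 ^ k)) \<le> C1 * real g * x powr (2 + \<epsilon>)" .
    \<comment> \<open>The assumption that the size bound does not exceed \<open>2 ^ w\<close> makes
      all addresses words.\<close>
    then have "real (R * (3 + 9 * 4 ^ k)) \<le> real (2 ^ w)" using fits by (simp add: x_def)
    then have fits': "R * (3 + 9 * 4 ^ k) \<le> 2 ^ w" by (simp only: of_nat_le_iff)
    obtain D where D: "\<forall>x \<in> set D. x < 2 ^ w" "length D = R * (3 + 9 * 4 ^ k)"
      "answers_access w search D code T (real ((2 * L + 8) * c'))"
      using access_structure[OF wf T(1) _ _ n2 nw _ R_def fits', of code] T(2) n code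
      by (auto simp: c'_def)
    have "real (2 * L + 8) \<le> (8 / \<epsilon> + 10) * (x / y)"
    proof -
      have "x / real k \<le> x / (\<epsilon> / 4 * y)" using xy assms ky k1 by (intro divide_left_mono) auto
      also have "\<dots> = 4 / \<epsilon> * (x / y)" by simp
      finally have "2 * (x / real k) \<le> 8 / \<epsilon> * (x / y)" by simp
      moreover have "1 \<le> x / y" using xy by simp
      ultimately show ?thesis using L(2) by (simp only: distrib_right of_nat_add of_nat_mult)
    qed
    then have "real ((2 * L + 8) * c') \<le> (8 / \<epsilon> + 10) * (x / y) * real c'"
      unfolding of_nat_mult[of "2 * L + 8"] by (intro mult_right_mono) auto
    also have "\<dots> = C2 * (x / y)" by (simp add: C2_def)
    finally have "answers_access w search D code T (C2 * (x / y))"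
      using D(3) unfolding answers_access_def by (meson order_trans)
    then show ?thesis using D len by (auto simp: x_def y_def)
  qed
  show ?thesis
    by (rule exI[of _ search], rule exI[of _ C1], rule exI[of _ C2]) (use C main in blast)
qed

end
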